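(* Let $\Gamma$ be a countable amenable group acting on a compact metrizable abelian group $X$ by automorphisms. Suppose that $\widehat{X}$ is a finitely generated left $\mathbb{Z}\Gamma$-module. Then $\Delta^1(X)\subseteq\mathrm{IE}(X)$.
   Context: $\widehat{X}$ is the Pontryagin dual of $X$ with the induced left module structure over the integral group ring $\mathbb{Z}\Gamma$. For $x\in X$ and $\varphi\in\widehat{X}$ let $\Psi_{x,\varphi}(s)=\langle sx,\varphi\rangle-1$ for $s\in\Gamma$, with $\langle\cdot,\cdot\rangle:X\times\widehat{X}\to\mathbb{T}$ the canonical pairing. $\Delta^1(X)$ is the set of $x\in X$ with $\sum_{s\in\Gamma}|\Psi_{x,\varphi}(s)|<+\infty$ for every $\varphi\in\widehat{X}$. $\mathrm{IE}(X)$: a finite set $F'\subseteq\Gamma$ is an independence set for a pair $(U_1,U_2)$ of subsets of $X$ if $\bigcap_{s\in F'}s^{-1}U_{\sigma(s)}\ne\emptyset$ for every $\sigma:F'\to\{1,2\}$. A point $x\in X$ lies in $\mathrm{IE}(X)$ if for all neighborhoods $U_1$ of $x$ and $U_2$ of $e_X$ there exist a nonempty finite $K\subseteq\Gamma$ and $c,\varepsilon>0$ such that every finite $F\subseteq\Gamma$ with $|KF\setminus F|\le\varepsilon|F|$ contains an independence set $F'\subseteq F$ for $(U_1,U_2)$ with $|F'|\ge c|F|$. *)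

theory Defs
  imports "HOL-Analysis.Analysis" "HOL-Library.Poly_Mapping" "HOL-Library.Countable"
begin

(* The acting group is a type of class group_add, Isabelle's class of not necessarily
   commutative groups. Its operation is written +, so s + t, - s and 0 stand for st, s^{-1}
   and the neutral element of Gamma. With this notation the type ('g, int) poly_mapping
   with its library ring structure (convolution product) is the integral group ring. *)

type_synonym 'g group_ring = "'g \<Rightarrow>\<^sub>0 int"

(* Folner's condition; K + F is the product set KF. *)
definition amenable :: "'g::group_add itself \<Rightarrow> bool" where
  "amenable _ \<longleftrightarrow>
     (\<forall>K::'g set. \<forall>\<epsilon>>0. finite K \<and> K \<noteq> {} \<longrightarrow>
        (\<exists>F. finite F \<and> F \<noteq> {} \<and> real (card ((K + F) - F)) \<le> \<epsilon> * real (card F)))"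

definition acts_by_automorphisms ::
    "('g::group_add \<Rightarrow> 'x::topological_ab_group_add \<Rightarrow> 'x) \<Rightarrow> bool" where
  "acts_by_automorphisms act \<longleftrightarrow>
     (\<forall>x. act 0 x = x) \<and>
     (\<forall>s t x. act (s + t) x = act s (act t x)) \<and>
     (\<forall>s x y. act s (x + y) = act s x + act s y) \<and>
     (\<forall>s. continuous_on UNIV (act s))"

(* The circle group is the unit circle in the complex plane, and the pairing of x with a
   character \<phi> is the value \<phi> x. The group operation of the dual is pointwise multiplication. *)
definition pontryagin_dual :: "('x::topological_ab_group_add \<Rightarrow> complex) set" where
  "pontryagin_dual =
     {\<phi>. continuous_on UNIV \<phi> \<and> (\<forall>x. norm (\<phi> x) = 1) \<and> (\<forall>x y. \<phi> (x + y) = \<phi> x * \<phi> y)}"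

(* The module structure induced by (s \<phi>)(x) = \<phi> (s^{-1} x); since the dual is written
   multiplicatively, integer coefficients become exponents. *)
definition dual_smult ::
    "('g::group_add \<Rightarrow> 'x \<Rightarrow> 'x) \<Rightarrow> 'g group_ring \<Rightarrow> ('x \<Rightarrow> complex) \<Rightarrow> 'x \<Rightarrow> complex" where
  "dual_smult act f \<phi> = (\<lambda>x. \<Prod>s\<in>Poly_Mapping.keys f. \<phi> (act (- s) x) powi Poly_Mapping.lookup f s)"

definition dual_finitely_generated ::
    "('g::group_add \<Rightarrow> 'x::topological_ab_group_add \<Rightarrow> 'x) \<Rightarrow> bool" where
  "dual_finitely_generated act \<longleftrightarrow>
     (\<exists>B. finite B \<and> B \<subseteq> pontryagin_dual \<and>
        (\<forall>\<phi>\<in>pontryagin_dual. \<exists>a. \<phi> = (\<lambda>x. \<Prod>\<beta>\<in>B. dual_smult act (a \<beta>) \<beta> x)))"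

definition Psi :: "('g \<Rightarrow> 'x \<Rightarrow> 'x) \<Rightarrow> 'x \<Rightarrow> ('x \<Rightarrow> complex) \<Rightarrow> 'g \<Rightarrow> complex" where
  "Psi act x \<phi> s = \<phi> (act s x) - 1"

definition Delta1 :: "('g \<Rightarrow> 'x::topological_ab_group_add \<Rightarrow> 'x) \<Rightarrow> 'x set" where
  "Delta1 act = {x. \<forall>\<phi>\<in>pontryagin_dual. (\<lambda>s. norm (Psi act x \<phi> s)) summable_on UNIV}"

definition independence_set ::
    "('g::group_add \<Rightarrow> 'x \<Rightarrow> 'x) \<Rightarrow> 'x set \<Rightarrow> 'x set \<Rightarrow> 'g set \<Rightarrow> bool" where
  "independence_set act U1 U2 F' \<longleftrightarrow>
     finite F' \<and>
     (\<forall>\<sigma> \<in> F' \<rightarrow> {1, 2::nat}. (\<Inter>s\<in>F'. act (- s) ` (if \<sigma> s = 1 then U1 else U2)) \<noteq> {})"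

(* Neighbourhoods are not required to be open. *)
definition IE :: "('g::group_add \<Rightarrow> 'x::topological_ab_group_add \<Rightarrow> 'x) \<Rightarrow> 'x set" where
  "IE act =
     {x. \<forall>U1 U2. x \<in> interior U1 \<and> 0 \<in> interior U2 \<longrightarrow>
        (\<exists>K c \<epsilon>. finite K \<and> K \<noteq> {} \<and> c > 0 \<and> \<epsilon> > 0 \<and>
           (\<forall>F. finite F \<and> real (card ((K + F) - F)) \<le> \<epsilon> * real (card F) \<longrightarrow>
              (\<exists>F'\<subseteq>F. independence_set act U1 U2 F' \<and> real (card F') \<ge> c * real (card F))))}"

(* The left module laws for dual_smult. *)

lemma dual_smult_superset:
  assumes "finite S" "Poly_Mapping.keys f \<subseteq> S"
  shows "dual_smult act f \<phi> x = (\<Prod>s\<in>S. \<phi> (act (- s) x) powi Poly_Mapping.lookup f s)"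
  unfolding dual_smult_def
  using assms by (intro prod.mono_neutral_left) (auto simp: in_keys_iff)

lemma dual_nonzero: "\<phi> \<in> pontryagin_dual \<Longrightarrow> \<phi> x \<noteq> 0"
  by (force simp: pontryagin_dual_def dest: spec[of _ x])

lemma dual_smult_closed:
  assumes "acts_by_automorphisms act" "\<phi> \<in> pontryagin_dual"
  shows "dual_smult act f \<phi> \<in> pontryagin_dual"
proof -
  have c: "continuous_on UNIV (\<lambda>x. \<phi> (act s x))" for s
    using assms unfolding acts_by_automorphisms_def pontryagin_dual_def
    by (auto intro: continuous_on_compose2)
  have "continuous_on UNIV (dual_smult act f \<phi>)"
    unfolding dual_smult_def using dual_nonzero[OF assms(2)]
    by (intro continuous_on_prod continuous_on_power_int c) auto
  then show ?thesis
    using assms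
    by (auto simp: pontryagin_dual_def dual_smult_def acts_by_automorphisms_def prod_norm[symmetric]
        norm_power_int power_int_mult_distrib prod.distrib)
qed

lemma dual_smult_single: "dual_smult act (Poly_Mapping.single s n) \<phi> x = \<phi> (act (- s) x) powi n"
  by (simp add: dual_smult_def)

lemma dual_smult_zero: "dual_smult act 0 \<phi> x = 1"
  by (simp add: dual_smult_def)

lemma dual_smult_one: "acts_by_automorphisms act \<Longrightarrow> dual_smult act 1 \<phi> = \<phi>"
  using dual_smult_single[of act 0 1] by (auto simp: acts_by_automorphisms_def)

lemma dual_smult_mult_right:
  "dual_smult act f (\<lambda>x. \<phi> x * \<psi> x) = (\<lambda>x. dual_smult act f \<phi> x * dual_smult act f \<psi> x)"
  by (simp add: dual_smult_def power_int_mult_distrib prod.distrib)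

lemma dual_smult_add:
  assumes "\<phi> \<in> pontryagin_dual"
  shows "dual_smult act (f + g) \<phi> x = dual_smult act f \<phi> x * dual_smult act g \<phi> x"
proof -
  let ?S = "Poly_Mapping.keys f \<union> Poly_Mapping.keys g"
  have "Poly_Mapping.keys (f + g) \<subseteq> ?S" by (rule keys_add)
  then show ?thesis
    by (simp add: dual_smult_superset[of ?S] lookup_add power_int_add dual_nonzero[OF assms]
        prod.distrib)
qed

lemma dual_smult_diff:
  assumes "\<phi> \<in> pontryagin_dual"
  shows "dual_smult act (f - g) \<phi> x = dual_smult act f \<phi> x / dual_smult act g \<phi> x"
proof -
  have "dual_smult act g \<phi> x \<noteq> 0"
    using dual_nonzero[OF assms] by (simp add: dual_smult_def)
  then show ?thesis
    using dual_smult_add[OF assms, of act "f - g" g x] by (simp add: field_simps)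
qed

lemma dual_smult_smult:
  assumes "acts_by_automorphisms act" "\<phi> \<in> pontryagin_dual"
  shows "dual_smult act (f * g) \<phi> = dual_smult act f (dual_smult act g \<phi>)"
proof (rule ext)
  fix x
  note d = dual_smult_closed[OF assms]
  have single: "dual_smult act (Poly_Mapping.single s 1 * g) \<phi> x = dual_smult act g \<phi> (act (- s) x)" for s x
    using subset_UNIV
  proof (induction g rule: frag_induction)
    case (one t)
    have "act (- (s + t)) x = act (- t) (act (- s) x)"
      using assms(1) by (simp only: acts_by_automorphisms_def minus_add)
    then show ?case
      by (simp add: mult_single dual_smult_single)
  next
    case (diff a b)
    then show ?case
      by (simp add: right_diff_distrib dual_smult_diff[OF assms(2)])
  qed (simp_all add: dual_smult_zero)
  show "dual_smult act (f * g) \<phi> x = dual_smult act f (dual_smult act g \<phi>) x"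
    using subset_UNIV
  proof (induction f rule: frag_induction)
    case (one t)
    then show ?case by (simp add: single dual_smult_single)
  next
    case (diff a b)
    then show ?case
      by (simp add: left_diff_distrib dual_smult_diff[OF assms(2)] dual_smult_diff[OF d])
  qed (simp_all add: dual_smult_zero)
qed

end

theory Submission
  imports Defs
begin

text \<open>
  Let \<open>x \<in> \<Delta>\<^sup>1(X)\<close>. Finitely many characters \<open>\<phi>\<close> define the relevant neighbourhood of \<open>0\<close>, and for
  them \<open>\<Sum>\<^sub>s |\<phi>(s x) - 1|\<close> is small outside a finite set \<open>E \<subseteq> \<Gamma>\<close>. Every finite \<open>F\<close> contains \<open>F'\<close> with
  \<open>|F| \<le> |E| |F'|\<close> whose quotients \<open>t s\<^sup>-\<^sup>1\<close> (\<open>s \<noteq> t\<close>) avoid \<open>E\<close>; then the subset sums of the points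
  \<open>s\<^sup>-\<^sup>1 x\<close>, \<open>s \<in> F'\<close>, witness that \<open>F'\<close> is an independence set.

  That characters define the topology of \<open>X\<close> is proved without Haar measure. A continuous \<open>f\<close> with
  \<open>f(x) \<noteq> f(0)\<close> yields a totally bounded invariant seminorm \<open>\<rho>\<close> on \<open>X\<close> with \<open>\<rho>(x) > 0\<close>. By pigeonhole,
  any finite set \<open>S \<subseteq> X\<close> has a common almost-period \<open>N\<close>, so \<open>(\<int>/N)\<^sup>S \<rightarrow> X\<close> is almost a homomorphism.
  Fourier analysis on this finite group finds a character with a large coefficient on a difference of
  translates of \<open>\<rho>\<close>; a large coefficient forces the character to be Lipschitz for \<open>\<rho>\<close> and nontrivial
  at \<open>x\<close>, with constants independent of \<open>S\<close>. Tychonoff's theorem then gives a character of \<open>X\<close>.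
\<close>

section \<open>Fourier analysis on finite abelian groups\<close>

text \<open>For nonempty \<open>A\<close> this is a finite abelian group: bijectivity of the
  translations replaces neutral element and inverses. \<open>M\<close> only indexes characters, and
  summing over \<open>M\<close> in \<open>orthogonality\<close> is the form that Plancherel
  consumes.\<close>

locale finite_fourier =
  fixes A :: "'a set" and add :: "'a \<Rightarrow> 'a \<Rightarrow> 'a" and M :: "'m set" and e :: "'m \<Rightarrow> 'a \<Rightarrow> complex"
  assumes finite_A: "finite A"
    and add_closed: "k \<in> A \<Longrightarrow> h \<in> A \<Longrightarrow> add k h \<in> A"
    and add_commute: "k \<in> A \<Longrightarrow> h \<in> A \<Longrightarrow> add k h = add h k"
    and add_assoc: "k \<in> A \<Longrightarrow> h \<in> A \<Longrightarrow> l \<in> A \<Longrightarrow> add (add k h) l = add k (add h l)"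
    and add_bij: "h \<in> A \<Longrightarrow> bij_betw (\<lambda>k. add k h) A A"
    and char_add: "m \<in> M \<Longrightarrow> k \<in> A \<Longrightarrow> h \<in> A \<Longrightarrow> e m (add k h) = e m k * e m h"
    and char_norm: "m \<in> M \<Longrightarrow> k \<in> A \<Longrightarrow> norm (e m k) = 1"
    and orthogonality: "k \<in> A \<Longrightarrow> h \<in> A \<Longrightarrow>
      (\<Sum>m\<in>M. e m k * cnj (e m h)) = (if k = h then of_nat (card A) else 0)"
begin

definition fourier :: "('a \<Rightarrow> complex) \<Rightarrow> 'm \<Rightarrow> complex" where
  "fourier F m = (\<Sum>k\<in>A. F k * cnj (e m k))"

lemma plancherel:
  "(\<Sum>m\<in>M. fourier F m * cnj (fourier G m)) = of_nat (card A) * (\<Sum>k\<in>A. F k * cnj (G k))"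
proof -
  have "(\<Sum>m\<in>M. fourier F m * cnj (fourier G m)) =
      (\<Sum>m\<in>M. \<Sum>k\<in>A. \<Sum>h\<in>A. F k * cnj (G h) * (e m h * cnj (e m k)))"
    by (simp add: fourier_def sum_product mult_ac)
  also have "\<dots> = (\<Sum>k\<in>A. \<Sum>h\<in>A. F k * cnj (G h) * (\<Sum>m\<in>M. e m h * cnj (e m k)))"
    unfolding sum_distrib_left
    by (subst sum.swap, rule sum.cong[OF refl], subst sum.swap, rule refl)
  also have "\<dots> = (\<Sum>k\<in>A. \<Sum>h\<in>A. if h = k then F k * cnj (G h) * of_nat (card A) else 0)"
    by (intro sum.cong refl) (simp add: orthogonality)
  also have "\<dots> = of_nat (card A) * (\<Sum>k\<in>A. F k * cnj (G k))"
    by (simp add: finite_A sum_distrib_left mult_ac)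
  finally show ?thesis .
qed

lemma parseval:
  "(\<Sum>m\<in>M. (norm (fourier F m))\<^sup>2) = real (card A) * (\<Sum>k\<in>A. (norm (F k))\<^sup>2)"
proof -
  have "complex_of_real (\<Sum>m\<in>M. (norm (fourier F m))\<^sup>2) =
      of_real (real (card A) * (\<Sum>k\<in>A. (norm (F k))\<^sup>2))"
    using plancherel[of F F] by (simp only: of_real_sum of_real_mult complex_norm_square of_real_of_nat_eq)
  then show ?thesis by (simp only: of_real_eq_iff)
qed

lemma fourier_shift:
  assumes "h \<in> A" "m \<in> M"
  shows "fourier (\<lambda>k. F (add k h)) m = e m h * fourier F m"
proof -
  have 1: "e m h * cnj (e m h) = 1"
    using char_norm[OF assms(2,1)] complex_norm_square[of "e m h"] by simp
  have "e m h * fourier F m = e m h * (\<Sum>k\<in>A. F (add k h) * cnj (e m (add k h)))"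
    unfolding fourier_def
    using sum.reindex_bij_betw[OF add_bij[OF assms(1)], of "\<lambda>k. F k * cnj (e m k)"] by simp
  also have "\<dots> = (\<Sum>k\<in>A. F (add k h) * cnj (e m k) * (e m h * cnj (e m h)))"
    unfolding sum_distrib_left by (rule sum.cong) (auto simp: char_add assms)
  finally show ?thesis by (simp add: 1 fourier_def)
qed

lemma fourier_shift_sum:
  assumes "B \<subseteq> A" "m \<in> M"
  shows "fourier (\<lambda>k. \<Sum>t\<in>B. F (add k t)) m = (\<Sum>t\<in>B. e m t) * fourier F m"
proof -
  have "fourier (\<lambda>k. \<Sum>t\<in>B. F (add k t)) m = (\<Sum>t\<in>B. fourier (\<lambda>k. F (add k t)) m)"
    unfolding fourier_def sum_distrib_right by (rule sum.swap)
  also have "\<dots> = (\<Sum>t\<in>B. e m t * fourier F m)"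
    using assms by (intro sum.cong) (auto simp: fourier_shift)
  finally show ?thesis by (simp add: sum_distrib_right)
qed

text \<open>Parseval for the indicator of \<open>B\<close>, whose transform is the conjugate of the
  character sum.\<close>

lemma norm_sum_chars:
  assumes "B \<subseteq> A"
  shows "(\<Sum>m\<in>M. (norm (\<Sum>t\<in>B. e m t))\<^sup>2) = real (card A) * real (card B)"
proof -
  have "norm (\<Sum>t\<in>B. e m t) = norm (fourier (indicator B) m)" for m
  proof -
    have "fourier (indicator B) m = cnj (\<Sum>t\<in>B. e m t)"
      using assms finite_A by (simp add: fourier_def indicator_def Int_absorb1)
    then show ?thesis by (simp only: complex_mod_cnj)
  qed
  moreover have "(\<Sum>k\<in>A. (norm (indicator B k :: complex))\<^sup>2) = real (card B)"
  proof -
    have "(norm (indicator B k :: complex))\<^sup>2 = (if k \<in> B then 1 else 0)" for k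
      by (simp add: indicator_def)
    then show ?thesis
      using assms finite_A by (simp add: sum.If_cases Int_absorb1)
  qed
  ultimately show ?thesis by (simp add: parseval)
qed

lemma fourier_diff: "fourier (\<lambda>k. F k - G k) m = fourier F m - fourier G m"
  by (simp add: fourier_def left_diff_distrib sum_subtractf)

lemma norm_fourier_le:
  assumes "m \<in> M" "\<And>k. k \<in> A \<Longrightarrow> norm (F k) \<le> b"
  shows "norm (fourier F m) \<le> real (card A) * b"
  unfolding fourier_def
  by (rule order_trans[OF sum_norm_le[where g = "\<lambda>_. b"]]) (auto simp: norm_mult char_norm assms)

text \<open>By Plancherel the summed autocorrelation is a sum over \<open>m\<close> of the squared
  coefficient of \<open>F\<close> against the conjugate character sum of \<open>B\<close>. One
  factor of the coefficient is estimated by \<open>\<alpha>\<close>, the other goes into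
  Cauchy-Schwarz, and both resulting square sums are known by \<open>parseval\<close> and
  \<open>norm_sum_chars\<close>.\<close>

lemma correlation_bound:
  fixes F :: "'a \<Rightarrow> real"
  assumes "B \<subseteq> A" and \<alpha>: "\<And>m. m \<in> M \<Longrightarrow> norm (fourier (\<lambda>k. of_real (F k)) m) \<le> \<alpha>" "\<alpha> \<ge> 0" and "A \<noteq> {}"
  shows "(\<Sum>t\<in>B. \<Sum>k\<in>A. F k * F (add k t))\<^sup>2 \<le> \<alpha>\<^sup>2 * ((\<Sum>k\<in>A. (F k)\<^sup>2) * real (card B))"
proof -
  let ?a = "fourier (\<lambda>k. of_real (F k))" and ?b = "\<lambda>m. \<Sum>t\<in>B. e m t" and ?n = "real (card A)"
  define X where "X = (\<Sum>t\<in>B. \<Sum>k\<in>A. F k * F (add k t))"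
  have n: "?n > 0" using assms finite_A by (simp add: card_gt_0_iff)
  have "of_real (?n * X) = of_nat (card A) * (\<Sum>k\<in>A. of_real (F k) * cnj (\<Sum>t\<in>B. of_real (F (add k t))))"
    unfolding X_def by (subst sum.swap) (simp add: sum_distrib_left)
  also have "\<dots> = (\<Sum>m\<in>M. ?a m * cnj (?b m * ?a m))"
    using assms(1) by (subst plancherel[symmetric]) (simp add: fourier_shift_sum[where F = "\<lambda>k. of_real (F k)"])
  finally have "norm (complex_of_real (?n * X)) \<le> (\<Sum>m\<in>M. norm (?a m) * norm (?a m) * norm (?b m))"
    by (auto intro!: sum_norm_le simp: norm_mult simp del: cnj_sum)
  also have "\<dots> \<le> (\<Sum>m\<in>M. \<alpha> * norm (?a m) * norm (?b m))"
    by (intro sum_mono mult_right_mono \<alpha>) auto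
  also have "\<dots> = \<alpha> * (\<Sum>m\<in>M. norm (?a m) * norm (?b m))"
    by (simp add: sum_distrib_left mult_ac)
  finally have "\<bar>?n * X\<bar> \<le> \<alpha> * (\<Sum>m\<in>M. norm (?a m) * norm (?b m))"
    by (simp only: norm_of_real)
  then have "\<bar>?n * X\<bar> \<le> \<bar>\<alpha> * (\<Sum>m\<in>M. norm (?a m) * norm (?b m))\<bar>"
    by linarith
  then have "(?n * X)\<^sup>2 \<le> (\<alpha> * (\<Sum>m\<in>M. norm (?a m) * norm (?b m)))\<^sup>2"
    by (simp only: abs_le_square_iff)
  also have "\<dots> \<le> \<alpha>\<^sup>2 * ((\<Sum>m\<in>M. (norm (?a m))\<^sup>2) * (\<Sum>m\<in>M. (norm (?b m))\<^sup>2))"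
    unfolding power_mult_distrib by (intro mult_left_mono Cauchy_Schwarz_ineq_sum) auto
  also have "\<dots> = ?n\<^sup>2 * (\<alpha>\<^sup>2 * ((\<Sum>k\<in>A. (F k)\<^sup>2) * real (card B)))"
    unfolding parseval norm_sum_chars[OF assms(1)] by (simp add: power2_eq_square mult_ac)
  finally have "?n\<^sup>2 * X\<^sup>2 \<le> ?n\<^sup>2 * (\<alpha>\<^sup>2 * ((\<Sum>k\<in>A. (F k)\<^sup>2) * real (card B)))"
    by (simp add: power_mult_distrib)
  then show ?thesis using n by (simp add: X_def)
qed

text \<open>The difference \<open>F\<close> of \<open>r\<close> and its translate by
  \<open>\<xi>\<close> is large near the neutral element and nearly invariant under the small ball
  \<open>B\<close>. Its autocorrelation over \<open>B\<close> is then too large for all Fourier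
  coefficients to be small, and a large coefficient controls the character. Only a Lipschitz
  condition under translation is imposed on \<open>r\<close>, so that a seminorm plus a constant
  error is admissible.\<close>

proposition character_controlled_by_seminorm:
  fixes r :: "'a \<Rightarrow> real"
  assumes r: "\<And>k. k \<in> A \<Longrightarrow> 0 \<le> r k" "\<And>k. k \<in> A \<Longrightarrow> r k \<le> D" "D > 0"
    and lip: "\<And>k h. k \<in> A \<Longrightarrow> h \<in> A \<Longrightarrow> \<bar>r (add k h) - r k\<bar> \<le> r h"
    and \<xi>: "\<xi> \<in> A" "r \<xi> \<ge> w" "w > 0"
    and \<beta>0: "\<beta>0 > 0" "\<beta>0 * real (card A) \<le> real (card {k\<in>A. r k \<le> w / 4})"
    and \<beta>: "\<beta> > 0" "\<beta> * real (card A) \<le> real (card {k\<in>A. r k \<le> \<beta>0 * w\<^sup>2 / (16 * D)})"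
    and c: "c > 0" "16 * c\<^sup>2 < \<beta> * \<beta>0 * w\<^sup>2"
  obtains m where "m \<in> M" "\<And>h. h \<in> A \<Longrightarrow> norm (e m h - 1) \<le> 2 / c * r h"
    "norm (e m \<xi> - 1) \<ge> c / D"
proof -
  define n where "n = real (card A)"
  have n: "n > 0" using finite_A \<xi> by (auto simp: card_gt_0_iff n_def)
  \<comment> \<open>Chosen so that the loss \<open>n * (D * (2 * \<epsilon>))\<close> in
    \<open>corr\<close> is half of the lower bound for \<open>L\<close>.\<close>
  define \<epsilon> where "\<epsilon> = \<beta>0 * w\<^sup>2 / (16 * D)"
  define B0 where "B0 = {k\<in>A. r k \<le> w / 4}"
  define B where "B = {k\<in>A. r k \<le> \<epsilon>}"
  define F where "F k = r (add k \<xi>) - r k" for k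
  define L where "L = (\<Sum>k\<in>A. (F k)\<^sup>2)"
  define b where "b = real (card B)"
  have B: "B \<subseteq> A" and B0: "B0 \<subseteq> A" by (auto simp: B_def B0_def)
  have b: "\<beta> * n \<le> b" using \<beta>(2) by (simp add: b_def B_def n_def \<epsilon>_def)
  with \<beta>(1) n have b0: "b > 0" using mult_pos_pos[of \<beta> n] by linarith
  have F_le: "\<bar>F k\<bar> \<le> D" if "k \<in> A" for k
    using lip[OF that \<xi>(1)] r(2)[OF \<xi>(1)] by (simp add: F_def)
  have F_lip: "\<bar>F (add k t) - F k\<bar> \<le> 2 * r t" if "k \<in> A" "t \<in> A" for k t
  proof -
    have "add (add k t) \<xi> = add (add k \<xi>) t"
      using that \<xi>(1) by (simp add: add_assoc add_commute[of t])
    then show ?thesis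
      using lip[OF that] lip[OF add_closed[OF that(1) \<xi>(1)] that(2)] unfolding F_def by simp
  qed
  \<comment> \<open>On \<open>B0\<close> the Lipschitz condition gives
    \<open>r (add k \<xi>) \<ge> w - w / 4\<close> while \<open>r k \<le> w / 4\<close>, hence
    \<open>F k \<ge> w / 2\<close>.\<close>
  have "\<beta>0 * n * w\<^sup>2 / 4 \<le> real (card B0) * (w\<^sup>2 / 4)"
    using mult_right_mono[OF \<beta>0(2), of "w\<^sup>2/4"] by (simp add: n_def B0_def)
  also have "\<dots> = (\<Sum>k\<in>B0. w\<^sup>2 / 4)" by simp
  also have "\<dots> \<le> (\<Sum>k\<in>B0. (F k)\<^sup>2)"
  proof (rule sum_mono)
    fix k assume "k \<in> B0"
    then have k: "k \<in> A" "r k \<le> w / 4" by (auto simp: B0_def)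
    have "\<bar>r (add k \<xi>) - r \<xi>\<bar> \<le> r k" using lip[OF \<xi>(1) k(1)] add_commute[OF \<xi>(1) k(1)] by simp
    then have "w / 2 \<le> F k" using k(2) \<xi>(2) by (simp add: F_def)
    then have "(w/2)\<^sup>2 \<le> (F k)\<^sup>2" using \<xi>(3) by (intro power_mono) auto
    then show "w\<^sup>2 / 4 \<le> (F k)\<^sup>2" by (simp add: power_divide)
  qed
  also have "\<dots> \<le> L" unfolding L_def using B0 finite_A by (intro sum_mono2) auto
  finally have L: "\<beta>0 * n * w\<^sup>2 / 4 \<le> L" .
  moreover have "\<beta>0 * n * w\<^sup>2 / 4 > 0" using \<beta>0(1) n \<xi>(3) by simp
  ultimately have L0: "L > 0" by linarith
  have corr: "L / 2 \<le> (\<Sum>k\<in>A. F k * F (add k t))" if "t \<in> B" for t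
  proof -
    have t: "t \<in> A" "r t \<le> \<epsilon>" using that by (auto simp: B_def)
    have "L - n * (D * (2 * \<epsilon>)) = (\<Sum>k\<in>A. (F k)\<^sup>2 - D * (2 * \<epsilon>))"
      by (simp add: sum_subtractf L_def n_def)
    also have "\<dots> \<le> (\<Sum>k\<in>A. F k * F (add k t))"
    proof (rule sum_mono)
      fix k assume k: "k \<in> A"
      have "\<bar>F k * (F (add k t) - F k)\<bar> \<le> D * (2 * \<epsilon>)"
        unfolding abs_mult using F_le[OF k] F_lip[OF k t(1)] t(2) r(3) by (intro mult_mono) auto
      then show "(F k)\<^sup>2 - D * (2 * \<epsilon>) \<le> F k * F (add k t)"
        by (simp add: power2_eq_square right_diff_distrib)
    qed
    moreover have "n * (D * (2 * \<epsilon>)) = \<beta>0 * n * w\<^sup>2 / 8"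
      using r(3) by (simp add: \<epsilon>_def)
    ultimately show ?thesis using L by linarith
  qed
  \<comment> \<open>Otherwise \<open>corr\<close> and \<open>correlation_bound\<close> give
    \<open>L * b \<le> 4 * (c * n)\<^sup>2\<close>, which contradicts the lower bounds for
    \<open>L\<close> and \<open>b\<close> by the choice of \<open>c\<close>.\<close>
  have "\<exists>m\<in>M. c * n < norm (fourier (\<lambda>k. of_real (F k)) m)"
  proof (rule ccontr)
    assume "\<not> (\<exists>m\<in>M. c * n < norm (fourier (\<lambda>k. of_real (F k)) m))"
    then have le: "norm (fourier (\<lambda>k. of_real (F k)) m) \<le> c * n" if "m \<in> M" for m
      using that by (simp add: not_less)
    have "b * (L / 2) = (\<Sum>t\<in>B. L / 2)" by (simp add: b_def)
    also have "\<dots> \<le> (\<Sum>t\<in>B. \<Sum>k\<in>A. F k * F (add k t))" by (rule sum_mono) (rule corr)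
    finally have "(b * (L / 2))\<^sup>2 \<le> (\<Sum>t\<in>B. \<Sum>k\<in>A. F k * F (add k t))\<^sup>2"
      using b0 L0 by (intro power_mono) auto
    also have "\<dots> \<le> (c * n)\<^sup>2 * (L * b)"
      unfolding L_def b_def using \<xi> c n by (intro correlation_bound B le) auto
    finally have "L * b * (L * b) \<le> (4 * (c * n)\<^sup>2) * (L * b)"
      by (simp add: power2_eq_square mult_ac)
    then have "L * b \<le> 4 * (c * n)\<^sup>2" using L0 b0 by simp
    moreover have "(\<beta>0 * n * w\<^sup>2 / 4) * (\<beta> * n) \<le> L * b"
      using L b L0 \<beta> n by (intro mult_mono) auto
    ultimately have "(\<beta> * \<beta>0 * w\<^sup>2) * n\<^sup>2 \<le> (16 * c\<^sup>2) * n\<^sup>2"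
      by (simp add: power2_eq_square mult_ac)
    then show False using c n by simp
  qed
  then obtain m where m: "m \<in> M" "c * n < norm (fourier (\<lambda>k. of_real (F k)) m)" by blast
  let ?f = "fourier (\<lambda>k. complex_of_real (F k)) m"
  have "norm (e m h - 1) \<le> 2 / c * r h" if h: "h \<in> A" for h
  proof -
    \<comment> \<open>Translation by \<open>h\<close> multiplies a coefficient by
      \<open>e m h\<close>, so this product is the transform of a function bounded by
      \<open>2 * r h\<close>; dividing by the large coefficient finishes.\<close>
    have "(e m h - 1) * ?f = fourier (\<lambda>k. of_real (F (add k h)) - of_real (F k)) m"
      by (simp add: fourier_diff fourier_shift[OF h m(1), of "\<lambda>k. of_real (F k)"] left_diff_distrib)
    moreover have "norm (complex_of_real (F (add k h)) - of_real (F k)) \<le> 2 * r h" if "k \<in> A" for k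
      using F_lip[OF that h] by (simp flip: of_real_diff)
    ultimately have "norm (e m h - 1) * norm ?f \<le> n * (2 * r h)"
      using norm_fourier_le[OF m(1)] by (simp flip: norm_mult add: n_def)
    moreover have "norm (e m h - 1) * (c * n) \<le> norm (e m h - 1) * norm ?f"
      using m(2) by (intro mult_left_mono) auto
    ultimately have "n * (norm (e m h - 1) * c) \<le> n * (2 * r h)" by (simp add: mult_ac)
    then show ?thesis using n c by (simp add: field_simps)
  qed
  moreover have "norm (e m \<xi> - 1) \<ge> c / D"
  proof -
    \<comment> \<open>The same identity for \<open>r\<close>, whose translate difference by
      \<open>\<xi>\<close> is \<open>F\<close> itself.\<close>
    have "(e m \<xi> - 1) * fourier (\<lambda>k. of_real (r k)) m = ?f"
      by (simp add: F_def fourier_diff fourier_shift[OF \<xi>(1) m(1), of "\<lambda>k. of_real (r k)"] left_diff_distrib)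
    moreover have "norm (fourier (\<lambda>k. of_real (r k)) m) \<le> n * D"
      unfolding n_def using r by (intro norm_fourier_le m) auto
    ultimately have "norm ?f \<le> norm (e m \<xi> - 1) * (n * D)"
      by (metis mult_left_mono norm_ge_zero norm_mult)
    with m(2) have "n * c \<le> n * (norm (e m \<xi> - 1) * D)" by (simp add: mult_ac)
    then show ?thesis using n r(3) by (simp add: field_simps)
  qed
  ultimately show thesis using that m(1) by blast
qed

end

section \<open>The group (Z/N)^S and its characters\<close>

definition grid :: "'s set \<Rightarrow> nat \<Rightarrow> ('s \<Rightarrow> nat) set" where
  "grid S N = PiE S (\<lambda>_. {..<N})"

definition grid_add :: "'s set \<Rightarrow> nat \<Rightarrow> ('s \<Rightarrow> nat) \<Rightarrow> ('s \<Rightarrow> nat) \<Rightarrow> 's \<Rightarrow> nat" where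
  "grid_add S N k h = (\<lambda>s\<in>S. (k s + h s) mod N)"

text \<open>The character exp(2 pi i (sum of m_s k_s) / N); the group is its own index set of
  characters.\<close>

definition grid_char :: "'s set \<Rightarrow> nat \<Rightarrow> ('s \<Rightarrow> nat) \<Rightarrow> ('s \<Rightarrow> nat) \<Rightarrow> complex" where
  "grid_char S N m k = (\<Prod>s\<in>S. (cis (2 * pi / real N) ^ m s) ^ k s)"

lemma power_mod_root_of_unity:
  fixes z :: "'a::monoid_mult"
  assumes "z ^ N = 1"
  shows "z ^ (a mod N) = z ^ a"
proof -
  have "z ^ a = (z ^ N) ^ (a div N) * z ^ (a mod N)"
    by (simp flip: power_mult power_add)
  then show ?thesis by (simp add: assms)
qed

lemma cis_root_of_unity: "N > 0 \<Longrightarrow> cis (2 * pi / real N) ^ N = 1"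
  by (simp add: Complex.DeMoivre)

text \<open>The summands are powers of an \<open>N\<close>-th root of unity \<open>z\<close>, which
  is 1 exactly when \<open>a = b\<close>; otherwise the geometric sum vanishes.\<close>

lemma cyclic_orthogonality:
  assumes "a < N" "b < N"
  defines "\<omega> \<equiv> cis (2 * pi / real N)"
  shows "(\<Sum>j<N. (\<omega> ^ j) ^ a * cnj ((\<omega> ^ j) ^ b)) = (if a = b then of_nat N else 0)"
proof -
  define z where "z = \<omega> ^ a * cnj (\<omega> ^ b)"
  have N: "N > 0" using assms by simp
  have 1: "\<omega> * cnj \<omega> = 1" using complex_norm_square[of \<omega>] by (simp add: \<omega>_def)
  have "(\<omega> ^ j) ^ a * cnj ((\<omega> ^ j) ^ b) = z ^ j" for j
    by (simp add: z_def power_mult_distrib mult.commute flip: power_mult)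
  then have eq: "(\<Sum>j<N. (\<omega> ^ j) ^ a * cnj ((\<omega> ^ j) ^ b)) = (\<Sum>j<N. z ^ j)" by simp
  show ?thesis
  proof (cases "a = b")
    case True
    then have "z = 1" by (simp add: z_def 1 flip: power_mult_distrib)
    then show ?thesis unfolding eq using True by simp
  next
    case False
    have "\<omega> ^ j = cis (2 * pi * real j / real N)" for j
      by (simp add: \<omega>_def Complex.DeMoivre mult_ac)
    then have "\<omega> ^ a \<noteq> \<omega> ^ b"
      using Complex.bij_betw_roots_unity[OF N] False assms(1,2)
      by (auto simp: bij_betw_def inj_on_def)
    moreover have "z * \<omega> ^ b = \<omega> ^ a * (\<omega> * cnj \<omega>) ^ b"
      by (simp only: z_def power_mult_distrib complex_cnj_power mult_ac)
    ultimately have z: "z \<noteq> 1" by (auto simp: 1)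
    have "\<omega> ^ N = 1" unfolding \<omega>_def by (rule cis_root_of_unity[OF N])
    moreover have "z ^ N = (\<omega> ^ N) ^ a * cnj ((\<omega> ^ N) ^ b)"
      by (simp add: z_def power_mult_distrib mult.commute flip: power_mult)
    ultimately have "z ^ N = 1" by simp
    then show ?thesis unfolding eq using z False by (simp add: geometric_sum)
  qed
qed

lemma grid_add_closed: "N > 0 \<Longrightarrow> grid_add S N k h \<in> grid S N"
  by (auto simp: grid_add_def grid_def)

lemma finite_fourier_grid:
  assumes "finite S" "N > 0"
  shows "finite_fourier (grid S N) (grid_add S N) (grid S N) (grid_char S N)"
proof
  let ?\<omega> = "cis (2 * pi / real N)"
  have root: "(?\<omega> ^ j) ^ N = 1" for j
  proof -
    have "(?\<omega> ^ j) ^ N = (?\<omega> ^ N) ^ j" by (simp only: power_mult[symmetric] mult.commute)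
    then show ?thesis by (simp add: cis_root_of_unity[OF assms(2)])
  qed
  show fin: "finite (grid S N)"
    using assms by (auto simp: grid_def intro: finite_PiE)
  show "grid_add S N k h \<in> grid S N" for k h by (rule grid_add_closed[OF assms(2)])
  show "grid_add S N k h = grid_add S N h k" for k h
    by (simp add: grid_add_def add.commute)
  show "grid_add S N (grid_add S N k h) l = grid_add S N k (grid_add S N h l)" for k h l
    by (auto simp: grid_add_def add.assoc mod_simps)
  show "bij_betw (\<lambda>k. grid_add S N k h) (grid S N) (grid S N)" if h: "h \<in> grid S N" for h
  proof -
    have "grid S N \<subseteq> (\<lambda>k. grid_add S N k h) ` grid S N"
    proof
      fix k assume k: "k \<in> grid S N"
      \<comment> \<open>This is \<open>k\<close> minus \<open>h\<close>. An entry
        \<open>N - h s\<close> may equal \<open>N\<close>, but \<open>grid_add\<close> reduces the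
        sum modulo \<open>N\<close>.\<close>
      define l where "l = grid_add S N k (\<lambda>s. N - h s)"
      have "((k s + (N - h s)) mod N + h s) mod N = k s" if "s \<in> S" for s
      proof -
        have "h s < N" "k s < N" using h k that by (auto simp: grid_def)
        then show ?thesis by (simp add: mod_simps)
      qed
      then have "grid_add S N l h = k"
        using k by (auto simp: grid_add_def l_def grid_def fun_eq_iff PiE_def extensional_def)
      moreover have "l \<in> grid S N" unfolding l_def by (rule grid_add_closed[OF assms(2)])
      ultimately show "k \<in> (\<lambda>k. grid_add S N k h) ` grid S N" by blast
    qed
    then have im: "(\<lambda>k. grid_add S N k h) ` grid S N = grid S N"
      using grid_add_closed[OF assms(2)] by blast
    then have "inj_on (\<lambda>k. grid_add S N k h) (grid S N)"
      by (intro eq_card_imp_inj_on fin) simp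
    then show ?thesis using im by (simp add: bij_betw_def)
  qed
  show "grid_char S N m (grid_add S N k h) = grid_char S N m k * grid_char S N m h" for m k h
    by (simp add: grid_char_def grid_add_def power_mod_root_of_unity[OF root] power_add prod.distrib)
  show "norm (grid_char S N m k) = 1" for m k
    by (simp add: grid_char_def norm_power flip: prod_norm)
  show "(\<Sum>m\<in>grid S N. grid_char S N m k * cnj (grid_char S N m h)) =
      (if k = h then of_nat (card (grid S N)) else 0)"
    if k: "k \<in> grid S N" and h: "h \<in> grid S N" for k h
  proof -
    \<comment> \<open>The sum over the product set factors into one cyclic sum per
      coordinate.\<close>
    have "(\<Sum>m\<in>grid S N. grid_char S N m k * cnj (grid_char S N m h)) =
        (\<Prod>s\<in>S. \<Sum>j<N. (?\<omega> ^ j) ^ k s * cnj ((?\<omega> ^ j) ^ h s))"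
      unfolding grid_def using assms(1) by (subst prod_sum_PiE) (auto simp: grid_char_def prod.distrib)
    also have "\<dots> = (\<Prod>s\<in>S. if k s = h s then of_nat N else 0)"
      using k h by (intro prod.cong refl cyclic_orthogonality) (auto simp: grid_def)
    also have "\<dots> = (if k = h then of_nat (card (grid S N)) else 0)"
    proof (cases "k = h")
      case True
      then show ?thesis using assms(1) by (simp add: grid_def card_PiE)
    next
      case False
      then obtain s where "s \<in> S" "k s \<noteq> h s"
        using k h PiE_ext[of k S _ h] unfolding grid_def by blast
      then have "(\<Prod>s\<in>S. if k s = h s then of_nat N else 0) = (0::complex)"
        using assms(1) by (intro prod_zero) auto
      then show ?thesis using False by simp
    qed
    finally show ?thesis .
  qed
qed

section \<open>Totally bounded seminorms on abelian groups\<close>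

definition nmul :: "nat \<Rightarrow> 'x::ab_group_add \<Rightarrow> 'x" where
  "nmul n x = (\<Sum>i<n. x)"

lemma nmul_simps [simp]: "nmul 0 x = 0" "nmul (Suc 0) x = x"
  by (auto simp: nmul_def)

lemma nmul_add: "nmul (m + n) x = nmul m x + nmul n x"
  by (induction n) (simp_all add: nmul_def add_ac)

lemma nmul_diff: "n \<le> m \<Longrightarrow> nmul (m - n) x = nmul m x - nmul n x"
  using nmul_add[of "m - n" n x] by simp

text \<open>Evaluates representatives in 0..N-1, so on (Z/N)^S it is additive only up to the carries
  \<open>nmul N s\<close>.\<close>

definition grid_sum :: "'x::ab_group_add set \<Rightarrow> ('x \<Rightarrow> nat) \<Rightarrow> 'x" where
  "grid_sum S k = (\<Sum>s\<in>S. nmul (k s) s)"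

locale totally_bounded_seminorm =
  fixes \<rho> :: "'x::ab_group_add \<Rightarrow> real"
  assumes zero: "\<rho> 0 = 0" and minus: "\<rho> (- x) = \<rho> x" and triangle: "\<rho> (x + y) \<le> \<rho> x + \<rho> y"
    and totally_bounded: "\<epsilon> > 0 \<Longrightarrow> \<exists>T. finite T \<and> (\<forall>y. \<exists>t\<in>T. \<rho> (y - t) < \<epsilon>)"
begin

lemma nonneg: "\<rho> x \<ge> 0"
  using triangle[of x "- x"] by (simp add: zero minus)

lemma triangle_diff: "\<rho> (x - y) \<le> \<rho> x + \<rho> y"
  using triangle[of x "- y"] by (simp add: minus)

lemma minus_commute: "\<rho> (x - y) = \<rho> (y - x)"
  using minus[of "x - y"] by simp

lemma triangle_le: "\<rho> x \<le> \<rho> y + \<rho> (x - y)"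
  using triangle[of y "x - y"] by simp

lemma seminorm_sum: "\<rho> (\<Sum>i\<in>I. f i) \<le> (\<Sum>i\<in>I. \<rho> (f i))"
proof (induction I rule: infinite_finite_induct)
  case (insert i I)
  then show ?case using triangle[of "f i" "sum f I"] by simp
qed (auto simp: zero)

lemma bounded: "\<exists>D>0. \<forall>y. \<rho> y \<le> D"
proof -
  obtain T where T: "finite T" "\<forall>y. \<exists>t\<in>T. \<rho> (y - t) < 1"
    using totally_bounded[of 1] by auto
  have "\<rho> y \<le> (\<Sum>t\<in>T. \<rho> t) + 1" for y
  proof -
    obtain t where "t \<in> T" "\<rho> (y - t) < 1" using T by blast
    moreover from this have "\<rho> t \<le> (\<Sum>t\<in>T. \<rho> t)" using T by (intro member_le_sum) (auto simp: nonneg)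
    ultimately show ?thesis using triangle_le[of y t] by linarith
  qed
  moreover have "(\<Sum>t\<in>T. \<rho> t) + 1 > 0" by (intro add_nonneg_pos sum_nonneg) (auto simp: nonneg)
  ultimately show ?thesis by blast
qed

text \<open>Total boundedness restated as a finite colouring with small fibres, ready for the
  pigeonhole principle.\<close>

lemma net:
  assumes "\<epsilon> > 0"
  obtains T :: "'x set" and p where "finite T" "\<And>y. p y \<in> T" "\<And>y z. p y = p z \<Longrightarrow> \<rho> (y - z) < \<epsilon>"
proof -
  obtain T where T: "finite T" "\<forall>y. \<exists>t\<in>T. \<rho> (y - t) < \<epsilon> / 2"
    using totally_bounded[of "\<epsilon>/2"] assms by auto
  then obtain p where p: "\<And>y. p y \<in> T" "\<And>y. \<rho> (y - p y) < \<epsilon> / 2" by metis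
  have "\<rho> (y - z) < \<epsilon>" if "p y = p z" for y z
    using triangle_diff[of "y - p y" "z - p y"] p(2)[of y] p(2)[of z] that by simp
  then show thesis using that T(1) p(1) by blast
qed

text \<open>Pigeonhole on the vectors of colours of the multiples of all \<open>s \<in> S\<close>:
  two of them agree, and their difference is a common almost-period. Using even multiples makes the
  difference at least 2, so that unit vectors lie in the grid.\<close>

lemma recurrence:
  assumes "finite S" "\<eta> > 0"
  shows "\<exists>N\<ge>2. \<forall>s\<in>S. \<rho> (nmul N s) < \<eta>"
proof -
  obtain T :: "'x set" and p where Tp: "finite T" "\<And>y. p y \<in> T" "\<And>y z. p y = p z \<Longrightarrow> \<rho> (y - z) < \<eta>"
    using net[OF assms(2)] by blast
  define f where "f j = (\<lambda>s\<in>S. p (nmul (2 * j) s))" for j :: nat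
  have "range f \<subseteq> PiE S (\<lambda>_. T)" using Tp by (auto simp: f_def)
  then have "finite (range f)" by (rule finite_subset) (auto intro!: finite_PiE assms Tp)
  then have "\<not> inj f" using finite_imageD[of f UNIV] by auto
  then obtain i j where "i < j" "f i = f j" unfolding inj_def by (metis linorder_neq_iff)
  moreover have "\<rho> (nmul (2 * j - 2 * i) s) < \<eta>" if "s \<in> S" for s
  proof -
    have "p (nmul (2 * j) s) = p (nmul (2 * i) s)"
      using \<open>f i = f j\<close> that by (metis f_def restrict_apply')
    then show ?thesis using Tp(3) \<open>i < j\<close> by (simp add: nmul_diff)
  qed
  ultimately show ?thesis by (intro exI[of _ "2 * j - 2 * i"]) auto
qed

text \<open>In each coordinate the reduction modulo \<open>N\<close> subtracts either 0 or
  \<open>N\<close>, which costs at most \<open>\<rho> (nmul N s)\<close>.\<close>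

lemma grid_sum_almost_additive:
  assumes "k \<in> grid S N" "h \<in> grid S N"
  shows "\<rho> (grid_sum S (grid_add S N k h) - (grid_sum S k + grid_sum S h)) \<le> (\<Sum>s\<in>S. \<rho> (nmul N s))"
proof -
  have "\<rho> (nmul ((k s + h s) mod N) s - (nmul (k s) s + nmul (h s) s)) \<le> \<rho> (nmul N s)" if "s \<in> S" for s
  proof (cases "k s + h s < N")
    case True
    then show ?thesis by (simp add: nmul_add zero nonneg)
  next
    case False
    have "k s < N" "h s < N" using assms that by (auto simp: grid_def)
    then have "(k s + h s) mod N = k s + h s - N"
      using False by (simp add: le_mod_geq)
    then show ?thesis using False by (simp add: nmul_diff nmul_add minus)
  qed
  moreover have "grid_sum S (grid_add S N k h) - (grid_sum S k + grid_sum S h) =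
      (\<Sum>s\<in>S. nmul ((k s + h s) mod N) s - (nmul (k s) s + nmul (h s) s))"
    by (simp add: grid_sum_def grid_add_def sum_subtractf sum.distrib)
  ultimately show ?thesis
    by (auto intro!: order_trans[OF seminorm_sum] sum_mono)
qed

text \<open>Some fibre of the colouring has at least the average size, and it lies in a translate of
  the ball by any of its members. The density \<open>1 / real (card T)\<close> depends neither on
  \<open>S\<close> nor on \<open>N\<close>.\<close>

lemma grid_ball_card:
  fixes T :: "'t set"
  assumes S: "finite S" "N > 0" "(\<Sum>s\<in>S. \<rho> (nmul N s)) \<le> \<eta>"
    and T: "finite T" "\<And>y. p y \<in> T" "\<And>y z. p y = p z \<Longrightarrow> \<rho> (y - z) < \<epsilon> / 2"
    and \<eta>: "\<eta> \<le> \<epsilon> / 4"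
  shows "1 / real (card T) * real (card (grid S N)) \<le>
    real (card {k\<in>grid S N. \<rho> (grid_sum S k) + \<eta> \<le> \<epsilon>})"
proof -
  interpret finite_fourier "grid S N" "grid_add S N" "grid S N" "grid_char S N"
    by (rule finite_fourier_grid[OF S(1,2)])
  let ?A = "grid S N" and ?f = "\<lambda>k. p (grid_sum S k)"
  let ?B = "{k\<in>?A. \<rho> (grid_sum S k) + \<eta> \<le> \<epsilon>}"
  have Tpos: "card T > 0" using T(1) T(2)[of 0] by (auto simp: card_gt_0_iff)
  have "\<exists>y\<in>T. card (?f -` {y} \<inter> ?A) * card T \<ge> card ?A"
    using T Tpos by (intro pigeonhole_card) (auto simp: finite_A)
  then obtain y where y: "card ?A \<le> card (?f -` {y} \<inter> ?A) * card T" by blast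
  have "card (?f -` {y} \<inter> ?A) \<le> card ?B"
  proof (cases "?f -` {y} \<inter> ?A = {}")
    case False
    then obtain t where t: "t \<in> ?A" "?f t = y" by auto
    have "?f -` {y} \<inter> ?A \<subseteq> (\<lambda>k. grid_add S N k t) ` ?B"
    proof
      fix k assume k: "k \<in> ?f -` {y} \<inter> ?A"
      then obtain h where h: "h \<in> ?A" "k = grid_add S N h t"
        using add_bij[OF t(1)] by (auto simp: bij_betw_def)
      have "\<rho> (grid_sum S k - grid_sum S t) < \<epsilon> / 2" using k t by (intro T) auto
      moreover have "\<rho> (grid_sum S k - (grid_sum S h + grid_sum S t)) \<le> \<eta>"
        using grid_sum_almost_additive[OF h(1) t(1)] S(3) by (simp add: h(2))
      \<comment> \<open>Adding another \<open>\<eta>\<close> still stays within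
        \<open>\<epsilon>\<close>, since \<open>\<eta> \<le> \<epsilon> / 4\<close>.\<close>
      ultimately have "\<rho> (grid_sum S h) \<le> \<epsilon> / 2 + \<eta>"
        using triangle_diff[of "grid_sum S k - grid_sum S t" "grid_sum S k - (grid_sum S h + grid_sum S t)"]
        by (simp add: algebra_simps)
      then show "k \<in> (\<lambda>k. grid_add S N k t) ` ?B" using h \<eta> by auto
    qed
    then show ?thesis by (intro surj_card_le) (auto simp: finite_A)
  qed (simp add: card_eq_0_iff)
  then have "card ?A \<le> card ?B * card T" using y by (meson le_trans mult_le_mono1)
  then have "real (card ?A) \<le> real (card ?B) * real (card T)"
    by (simp only: of_nat_le_iff flip: of_nat_mult)
  then have "real (card ?A) / real (card T) \<le> real (card ?B)"
    using Tpos pos_divide_le_eq[of "real (card T)"] by (simp only: of_nat_0_less_iff)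
  then show ?thesis by (simp only: times_divide_eq_left mult_1)
qed

text \<open>The constants come from \<open>\<rho>\<close> and \<open>x\<close> alone, before
  \<open>S\<close> and \<open>\<eta>\<close> are given; this uniformity is what the compactness
  argument needs. The function is a character of the grid over an enlarged \<open>S\<close>, read
  off at unit vectors.\<close>

lemma approximate_character:
  assumes x: "\<rho> x > 0"
  obtains C c where "C > 0" "c > 0"
    "\<And>S \<eta>. finite S \<Longrightarrow> \<eta> > 0 \<Longrightarrow> \<exists>\<psi>::'x \<Rightarrow> complex.
      (\<forall>g. norm (\<psi> g) = 1) \<and> (\<forall>s\<in>S. \<forall>t\<in>S. norm (\<psi> (s + t) - \<psi> s * \<psi> t) \<le> \<eta>) \<and>
      (\<forall>s\<in>S. norm (\<psi> s - 1) \<le> C * \<rho> s + \<eta>) \<and> norm (\<psi> x - 1) \<ge> c"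
proof -
  define w where "w = \<rho> x"
  obtain D' where D': "D' > 0" "\<And>y. \<rho> y \<le> D'" using bounded by blast
  \<comment> \<open>The extra 1 leaves room for the error \<open>\<delta> \<le> 1\<close> added to
    \<open>\<rho>\<close> in \<open>r\<close>.\<close>
  define D where "D = D' + 1"
  have w: "w > 0" and D: "D > 0" using x D' by (auto simp: w_def D_def)
  obtain T0 :: "'x set" and p0 where T0: "finite T0" "\<And>y. p0 y \<in> T0"
      "\<And>y z. p0 y = p0 z \<Longrightarrow> \<rho> (y - z) < w / 4 / 2"
    using net[of "w / 4 / 2"] w by auto
  define \<beta>0 where "\<beta>0 = 1 / real (card T0)"
  have \<beta>0: "\<beta>0 > 0" using T0(1) T0(2)[of 0] by (auto simp: \<beta>0_def card_gt_0_iff)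
  define \<epsilon> where "\<epsilon> = \<beta>0 * w\<^sup>2 / (16 * D)"
  have \<epsilon>: "\<epsilon> > 0" using \<beta>0 w D by (simp add: \<epsilon>_def)
  obtain T :: "'x set" and p where T: "finite T" "\<And>y. p y \<in> T"
      "\<And>y z. p y = p z \<Longrightarrow> \<rho> (y - z) < \<epsilon> / 2"
    using net[of "\<epsilon> / 2"] \<epsilon> by auto
  define \<beta> where "\<beta> = 1 / real (card T)"
  have \<beta>: "\<beta> > 0" using T(1) T(2)[of 0] by (auto simp: \<beta>_def card_gt_0_iff)
  \<comment> \<open>Then \<open>16 * c\<^sup>2\<close> is a quarter of
    \<open>\<beta> * \<beta>0 * w\<^sup>2\<close>.\<close>
  define c where "c = sqrt (\<beta> * \<beta>0) * w / 8"
  have c: "c > 0" using \<beta> \<beta>0 w by (simp add: c_def)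
  have c2: "16 * c\<^sup>2 < \<beta> * \<beta>0 * w\<^sup>2"
    using \<beta> \<beta>0 w by (simp add: c_def power_mult_distrib power_divide)
  have "\<exists>\<psi>::'x \<Rightarrow> complex.
      (\<forall>g. norm (\<psi> g) = 1) \<and> (\<forall>s\<in>S. \<forall>t\<in>S. norm (\<psi> (s + t) - \<psi> s * \<psi> t) \<le> \<eta>) \<and>
      (\<forall>s\<in>S. norm (\<psi> s - 1) \<le> 2 / c * \<rho> s + \<eta>) \<and> norm (\<psi> x - 1) \<ge> c / D"
    if S: "finite S" and \<eta>: "\<eta> > 0" for S and \<eta> :: real
  proof -
    \<comment> \<open>The first entry makes the final error \<open>2 / c * (3 * \<delta>)\<close> at
      most \<open>\<eta>\<close>; the next two are a quarter of the radii of the two balls in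
      \<open>grid_ball_card\<close>.\<close>
    define \<delta> where "\<delta> = Min {\<eta> * c / 6, w / 16, \<epsilon> / 4, 1}"
    have \<delta>: "\<delta> > 0" "\<delta> \<le> \<eta> * c / 6" "\<delta> \<le> w / 4 / 4" "\<delta> \<le> \<epsilon> / 4" "\<delta> \<le> 1"
      using \<eta> c w \<epsilon> by (auto simp: \<delta>_def)
    \<comment> \<open>Sums of two points of \<open>S\<close> get coordinates of their own, so that
      the approximate character is defined at them through unit vectors.\<close>
    define R where "R = insert x (S \<union> (\<lambda>(s, t). s + t) ` (S \<times> S))"
    have R: "finite R" "x \<in> R" "S \<subseteq> R" "\<And>s t. s \<in> S \<Longrightarrow> t \<in> S \<Longrightarrow> s + t \<in> R"
      using S by (auto simp: R_def)
    have "\<exists>N\<ge>2. \<forall>s\<in>R. \<rho> (nmul N s) < \<delta> / (real (card R) + 1)"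
      using \<delta> by (intro recurrence R divide_pos_pos) auto
    then obtain N where N: "N \<ge> 2" "\<And>s. s \<in> R \<Longrightarrow> \<rho> (nmul N s) < \<delta> / (real (card R) + 1)" by blast
    have "(\<Sum>s\<in>R. \<rho> (nmul N s)) \<le> (\<Sum>s\<in>R. \<delta> / (real (card R) + 1))"
      using N by (intro sum_mono less_imp_le) auto
    also have "\<dots> \<le> \<delta>" using \<delta>(1) by (simp add: field_simps)
    finally have err: "(\<Sum>s\<in>R. \<rho> (nmul N s)) \<le> \<delta>" .
    have N0: "N > 0" using N by simp
    interpret finite_fourier "grid R N" "grid_add R N" "grid R N" "grid_char R N"
      by (rule finite_fourier_grid[OF R(1) N0])
    let ?A = "grid R N"
    \<comment> \<open>Adding \<open>\<delta>\<close> absorbs the failure of additivity, so the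
      Lipschitz condition holds exactly.\<close>
    define r where "r k = \<rho> (grid_sum R k) + \<delta>" for k
    have add_err: "\<rho> (grid_sum R (grid_add R N k h) - (grid_sum R k + grid_sum R h)) \<le> \<delta>"
      if "k \<in> ?A" "h \<in> ?A" for k h
      using grid_sum_almost_additive[OF that] err by simp
    define u where "u s = (\<lambda>t\<in>R. if t = s then 1 else 0 :: nat)" for s
    have u: "u s \<in> ?A" "grid_sum R (u s) = s" if "s \<in> R" for s
    proof -
      show "u s \<in> ?A" using N(1) by (auto simp: u_def grid_def)
      have "grid_sum R (u s) = (\<Sum>t\<in>R. if t = s then t else 0)"
        unfolding grid_sum_def by (rule sum.cong) (auto simp: u_def)
      then show "grid_sum R (u s) = s" using that R(1) by simp
    qed
    have lip: "\<bar>r (grid_add R N k h) - r k\<bar> \<le> r h" if "k \<in> ?A" "h \<in> ?A" for k h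
    proof -
      let ?a = "grid_sum R (grid_add R N k h)" and ?k = "grid_sum R k" and ?h = "grid_sum R h"
      have "\<rho> (?a - ?k) \<le> \<rho> ?h + \<delta>"
        using triangle[of ?h "?a - (?k + ?h)"] add_err[OF that] by (simp add: algebra_simps)
      then show ?thesis
        using triangle_le[of ?a ?k] triangle_le[of ?k ?a] minus_commute[of ?a ?k] by (auto simp: r_def)
    qed
    obtain m where m: "m \<in> ?A" "\<And>h. h \<in> ?A \<Longrightarrow> norm (grid_char R N m h - 1) \<le> 2 / c * r h"
      "norm (grid_char R N m (u x) - 1) \<ge> c / D"
    proof (rule character_controlled_by_seminorm[of r D "u x" w \<beta>0 \<beta> c])
      show "0 \<le> r k" for k using \<delta> by (simp add: r_def nonneg)
      show "r k \<le> D" for k using D'(2)[of "grid_sum R k"] \<delta> by (simp add: r_def D_def)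
      show "D > 0" "w > 0" "\<beta>0 > 0" "\<beta> > 0" "c > 0" "16 * c\<^sup>2 < \<beta> * \<beta>0 * w\<^sup>2" by fact+
      show "u x \<in> ?A" using u R by blast
      show "w \<le> r (u x)" using u(2)[OF R(2)] \<delta> by (simp add: r_def w_def)
      show "\<beta>0 * real (card ?A) \<le> real (card {k \<in> ?A. r k \<le> w / 4})"
        unfolding \<beta>0_def r_def by (rule grid_ball_card[OF R(1) N0 err T0 \<delta>(3)])
      show "\<beta> * real (card ?A) \<le> real (card {k \<in> ?A. r k \<le> \<beta>0 * w\<^sup>2 / (16 * D)})"
        unfolding \<beta>_def r_def using grid_ball_card[OF R(1) N0 err T \<delta>(4)] by (simp add: \<epsilon>_def)
    qed (use lip in auto)
    \<comment> \<open>Needed because \<open>u (s + t)\<close> and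
      \<open>grid_add R N (u s) (u t)\<close> may be different grid points, although their sums in
      the group nearly agree.\<close>
    have close: "norm (grid_char R N m k - grid_char R N m l) \<le> 2 / c * (\<rho> (grid_sum R k - grid_sum R l) + 2 * \<delta>)"
      if k: "k \<in> ?A" and l: "l \<in> ?A" for k l
    proof -
      obtain h where h: "h \<in> ?A" "k = grid_add R N h l"
        using add_bij[OF l] k by (auto simp: bij_betw_def)
      let ?k = "grid_sum R k" and ?h = "grid_sum R h" and ?l = "grid_sum R l"
      have "\<rho> ?h \<le> \<rho> (?k - ?l) + \<delta>"
        using triangle_diff[of "?k - ?l" "?k - (?h + ?l)"] add_err[OF h(1) l] by (simp add: h(2) algebra_simps)
      then have "r h \<le> \<rho> (?k - ?l) + 2 * \<delta>" by (simp add: r_def)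
      then have "2 / c * r h \<le> 2 / c * (\<rho> (?k - ?l) + 2 * \<delta>)" using c by (intro mult_left_mono) auto
      moreover have "grid_char R N m k - grid_char R N m l = (grid_char R N m h - 1) * grid_char R N m l"
        by (simp add: h(2) char_add[OF m(1) h(1) l] left_diff_distrib)
      ultimately show ?thesis
        using m(2)[OF h(1)] char_norm[OF m(1) l] by (simp add: norm_mult)
    qed
    \<comment> \<open>The default 1 outside \<open>R\<close> keeps all values on the unit
      circle.\<close>
    define \<psi> where "\<psi> g = (if g \<in> R then grid_char R N m (u g) else 1)" for g
    have "norm (\<psi> g) = 1" for g using char_norm[OF m(1)] u(1) by (simp add: \<psi>_def)
    moreover have "norm (\<psi> (s + t) - \<psi> s * \<psi> t) \<le> \<eta>" if "s \<in> S" "t \<in> S" for s t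
    proof -
      have R': "s \<in> R" "t \<in> R" "s + t \<in> R" using that R by auto
      note us = u[OF R'(1)] and ut = u[OF R'(2)] and ust = u[OF R'(3)]
      have "norm (\<psi> (s + t) - \<psi> s * \<psi> t) = norm (grid_char R N m (u (s + t)) - grid_char R N m (grid_add R N (u s) (u t)))"
        using R' by (simp add: \<psi>_def char_add[OF m(1) us(1) ut(1)])
      also have "\<dots> \<le> 2 / c * (\<rho> (s + t - grid_sum R (grid_add R N (u s) (u t))) + 2 * \<delta>)"
        using close[OF ust(1) add_closed[OF us(1) ut(1)]] by (simp add: ust(2))
      also have "\<dots> \<le> 2 / c * (\<delta> + 2 * \<delta>)"
        using add_err[OF us(1) ut(1)] c
        by (intro mult_left_mono) (auto simp: us(2) ut(2) minus_commute[of "s + t"])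
      also have "\<dots> \<le> \<eta>" using \<delta>(2) c by (simp add: field_simps)
      finally show ?thesis .
    qed
    moreover have "norm (\<psi> s - 1) \<le> 2 / c * \<rho> s + \<eta>" if "s \<in> S" for s
    proof -
      have s: "s \<in> R" using that R by auto
      have "norm (\<psi> s - 1) \<le> 2 / c * (\<rho> s + \<delta>)"
        using m(2)[OF u(1)[OF s]] s by (simp add: \<psi>_def r_def u(2))
      also have "\<dots> \<le> 2 / c * \<rho> s + \<eta>" using \<delta>(1,2) c by (simp add: field_simps)
      finally show ?thesis .
    qed
    moreover have "norm (\<psi> x - 1) \<ge> c / D" using m(3) R(2) by (simp add: \<psi>_def)
    ultimately show ?thesis by blast
  qed
  then show thesis using that[of "2 / c" "c / D"] c D by simp
qed

text \<open>In the product of circles, compact by Tychonoff, the approximate conditions are closed;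
  \<open>approximate_character\<close> gives the finite intersection property. A common point
  satisfies them for every positive tolerance, hence exactly.\<close>

proposition lipschitz_character:
  assumes "\<rho> x > 0"
  obtains C and \<psi> :: "'x \<Rightarrow> complex" where "\<And>g. norm (\<psi> g) = 1" "\<And>g h. \<psi> (g + h) = \<psi> g * \<psi> h"
    "\<And>g. norm (\<psi> g - 1) \<le> C * \<rho> g" "\<psi> x \<noteq> 1"
proof -
  obtain C c where "C > 0" "c > 0" and approx: "\<And>S \<eta>. finite S \<Longrightarrow> \<eta> > 0 \<Longrightarrow> \<exists>\<psi>::'x \<Rightarrow> complex.
      (\<forall>g. norm (\<psi> g) = 1) \<and> (\<forall>s\<in>S. \<forall>t\<in>S. norm (\<psi> (s + t) - \<psi> s * \<psi> t) \<le> \<eta>) \<and>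
      (\<forall>s\<in>S. norm (\<psi> s - 1) \<le> C * \<rho> s + \<eta>) \<and> norm (\<psi> x - 1) \<ge> c"
    using approximate_character[OF assms] by metis
  define Z :: "'x \<times> 'x \<times> real \<Rightarrow> ('x \<Rightarrow> complex) set" where
    "Z = (\<lambda>(s, t, \<eta>). {\<psi>. norm (\<psi> (s + t) - \<psi> s * \<psi> t) \<le> \<eta> \<and>
      norm (\<psi> s - 1) \<le> C * \<rho> s + \<eta> \<and> norm (\<psi> x - 1) \<ge> c})"
  let ?K = "PiE UNIV (\<lambda>_. sphere 0 1) :: ('x \<Rightarrow> complex) set"
  have "compactin (product_topology (\<lambda>_::'x. euclidean :: complex topology) UNIV) ?K"
    unfolding compactin_PiE by simp
  then have "compact ?K" by (simp add: euclidean_product_topology)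
  then have "?K \<inter> (\<Inter>i\<in>{(s, t, \<eta>). \<eta> > 0}. Z i) \<noteq> {}"
  proof (rule compact_imp_fip_image)
    fix i :: "'x \<times> 'x \<times> real"
    obtain s t \<eta> where i: "i = (s, t, \<eta>)" by (cases i)
    show "closed (Z i)"
      unfolding i Z_def split
      by (intro closed_Collect_conj closed_Collect_le continuous_intros continuous_on_product_coordinates)
  next
    fix I assume I: "finite I" "I \<subseteq> {(s::'x, t::'x, \<eta>::real). \<eta> > 0}"
    \<comment> \<open>All points and the smallest tolerance occurring in \<open>I\<close>; the 1
      covers empty \<open>I\<close>.\<close>
    define S where "S = fst ` I \<union> (fst \<circ> snd) ` I"
    define \<eta> where "\<eta> = Min (insert 1 ((snd \<circ> snd) ` I))"
    have "finite S" "\<eta> > 0" using I by (auto simp: S_def \<eta>_def)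
    then obtain \<psi> :: "'x \<Rightarrow> complex" where \<psi>: "\<And>g. norm (\<psi> g) = 1"
      "\<And>s t. s \<in> S \<Longrightarrow> t \<in> S \<Longrightarrow> norm (\<psi> (s + t) - \<psi> s * \<psi> t) \<le> \<eta>"
      "\<And>s. s \<in> S \<Longrightarrow> norm (\<psi> s - 1) \<le> C * \<rho> s + \<eta>" "norm (\<psi> x - 1) \<ge> c"
      using approx by metis
    have "\<psi> \<in> Z i" if "i \<in> I" for i
    proof -
      obtain s t \<theta> where i: "i = (s, t, \<theta>)" by (cases i)
      have st: "s \<in> S" "t \<in> S" using that by (force simp: S_def i)+
      have "\<eta> \<le> \<theta>" using that I(1) by (force simp: \<eta>_def i intro!: Min_le)
      then show ?thesis using \<psi>(2)[OF st] \<psi>(3)[OF st(1)] \<psi>(4) by (simp add: Z_def i)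
    qed
    moreover have "\<psi> \<in> ?K" using \<psi>(1) by (auto simp: PiE_iff)
    ultimately show "?K \<inter> (\<Inter>i\<in>I. Z i) \<noteq> {}" by blast
  qed
  then obtain \<psi> where K: "\<psi> \<in> ?K" and Z: "\<And>s t \<eta>. \<eta> > 0 \<Longrightarrow> \<psi> \<in> Z (s, t, \<eta>)" by blast
  show thesis
  proof
    show "norm (\<psi> g) = 1" for g using K by (auto simp: PiE_iff)
    have "norm (\<psi> (g + h) - \<psi> g * \<psi> h) \<le> 0" for g h
      by (rule field_le_epsilon) (use Z[of _ g h] in \<open>simp add: Z_def\<close>)
    then show "\<psi> (g + h) = \<psi> g * \<psi> h" for g h by simp
    show "norm (\<psi> g - 1) \<le> C * \<rho> g" for g
      by (rule field_le_epsilon) (use Z[of _ g] in \<open>simp add: Z_def\<close>)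
    show "\<psi> x \<noteq> 1" using Z[of 1] \<open>c > 0\<close> by (auto simp: Z_def)
  qed
qed

end

section \<open>Characters of compact metrizable abelian groups\<close>

lemma separating_function:
  fixes x :: "'x::topological_space"
  assumes "metrizable_space (euclidean :: 'x topology)" "x \<noteq> y"
  obtains f :: "'x \<Rightarrow> real" where "continuous_on UNIV f" "f x \<noteq> f y"
proof -
  obtain M d where d: "Metric_space M d" "(euclidean :: 'x topology) = Metric_space.mtopology M d"
    using assms(1) unfolding metrizable_space_def by blast
  interpret Metric_space M d by (rule d)
  have M: "M = UNIV" using topspace_mtopology d(2) by (metis topspace_euclidean)
  have "continuous_map mtopology euclideanreal (d y)"
    unfolding continuous_map_from_metric
  proof (intro conjI ballI allI impI)
    fix a U assume "openin euclideanreal U \<and> d y a \<in> U"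
    then obtain e where e: "e > 0" "\<And>r. \<bar>r - d y a\<bar> < e \<Longrightarrow> r \<in> U"
      by (auto simp: open_dist dist_real_def)
    have "\<bar>d y z - d y a\<bar> \<le> d a z" for z
      using triangle[of y a z] triangle[of y z a] by (simp add: M commute)
    then show "\<exists>r>0. \<forall>z. z \<in> M \<and> d a z < r \<longrightarrow> d y z \<in> U"
      using e by (intro exI[of _ e]) (meson le_less_trans)
  qed simp
  then have "continuous_on UNIV (d y)" by (simp flip: d(2))
  moreover have "d y x \<noteq> d y y" using assms(2) M by (metis UNIV_I zero)
  ultimately show thesis using that by blast
qed

text \<open>\<open>\<rho> h\<close> is the largest displacement of a separating function
  \<open>f\<close> under translation by \<open>h\<close>. Compactness makes it small near 0, and
  finitely many translates of such a neighbourhood cover the group, which is total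
  boundedness.\<close>

lemma separating_seminorm:
  fixes x :: "'x::topological_ab_group_add"
  assumes "compact (UNIV :: 'x set)" "metrizable_space (euclidean :: 'x topology)" "x \<noteq> 0"
  obtains \<rho> :: "'x \<Rightarrow> real" where "totally_bounded_seminorm \<rho>" "\<rho> x > 0"
    "\<And>\<epsilon>. \<epsilon> > 0 \<Longrightarrow> \<exists>V. open V \<and> 0 \<in> V \<and> (\<forall>h\<in>V. \<rho> h < \<epsilon>)"
proof -
  obtain f :: "'x \<Rightarrow> real" where f: "continuous_on UNIV f" "f x \<noteq> f 0"
    using separating_function[OF assms(2,3)] by blast
  have "bounded (range f)"
    using compact_continuous_image[OF f(1) assms(1)] by (rule compact_imp_bounded)
  then obtain b where b: "\<And>y. \<bar>f y\<bar> \<le> b" by (auto simp: bounded_iff)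
  define \<rho> where "\<rho> h = (SUP y. \<bar>f (y + h) - f y\<bar>)" for h
  have bdd: "bdd_above (range (\<lambda>y. \<bar>f (y + h) - f y\<bar>))" for h
  proof (rule bdd_aboveI)
    fix z assume "z \<in> range (\<lambda>y. \<bar>f (y + h) - f y\<bar>)"
    then obtain y where "z = \<bar>f (y + h) - f y\<bar>" by blast
    then show "z \<le> 2 * b" using b[of "y + h"] b[of y] by linarith
  qed
  have upper: "\<bar>f (y + h) - f y\<bar> \<le> \<rho> h" for y h
    unfolding \<rho>_def by (rule cSUP_upper[OF _ bdd]) simp
  have least: "\<rho> h \<le> a" if "\<And>y. \<bar>f (y + h) - f y\<bar> \<le> a" for h a
    unfolding \<rho>_def using that by (intro cSUP_least) auto
  have small: "\<exists>V. open V \<and> 0 \<in> V \<and> (\<forall>h\<in>V. \<rho> h < \<epsilon>)" if "\<epsilon> > 0" for \<epsilon>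
  proof -
    \<comment> \<open>The tube lemma turns this open set around \<open>{0} \<times> UNIV\<close>
      into a bound uniform in \<open>y\<close>. The half keeps the supremum strictly below
      \<open>\<epsilon>\<close>.\<close>
    let ?W = "{p :: 'x \<times> 'x. \<bar>f (snd p + fst p) - f (snd p)\<bar> < \<epsilon> / 2}"
    have "continuous_on UNIV (\<lambda>p :: 'x \<times> 'x. f (snd p + fst p))"
      by (rule continuous_on_compose2[OF f(1)]) (auto intro!: continuous_intros)
    moreover have "continuous_on UNIV (\<lambda>p :: 'x \<times> 'x. f (snd p))"
      by (rule continuous_on_compose2[OF f(1)]) (auto intro!: continuous_intros)
    ultimately have "open ?W" by (intro open_Collect_less continuous_intros)
    moreover have "{0} \<times> UNIV \<subseteq> ?W" using that by auto
    ultimately have "\<exists>V. 0 \<in> V \<and> open V \<and> V \<times> UNIV \<subseteq> ?W"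
      by (rule Elementary_Topology.tube_lemma[OF assms(1)])
    then obtain V where V: "0 \<in> V" "open V" "V \<times> UNIV \<subseteq> ?W" by blast
    have "\<rho> h < \<epsilon>" if "h \<in> V" for h
    proof -
      have "\<bar>f (y + h) - f y\<bar> < \<epsilon> / 2" for y
      proof -
        have "(h, y) \<in> ?W" using V(3) that by blast
        then show ?thesis by simp
      qed
      then have "\<rho> h \<le> \<epsilon> / 2" by (intro least less_imp_le)
      then show ?thesis using \<open>\<epsilon> > 0\<close> by simp
    qed
    then show ?thesis using V by blast
  qed
  have zero: "\<rho> 0 = 0" by (simp add: \<rho>_def)
  have minus_le: "\<rho> (- h) \<le> \<rho> h" for h
  proof (rule least)
    show "\<bar>f (y + - h) - f y\<bar> \<le> \<rho> h" for y
      using upper[of "y - h" h] by (simp add: abs_minus_commute)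
  qed
  have "totally_bounded_seminorm \<rho>"
  proof
    show "\<rho> 0 = 0" by fact
    show "\<rho> (- h) = \<rho> h" for h using minus_le[of h] minus_le[of "- h"] by simp
    show "\<rho> (h + k) \<le> \<rho> h + \<rho> k" for h k
    proof (rule least)
      show "\<bar>f (y + (h + k)) - f y\<bar> \<le> \<rho> h + \<rho> k" for y
        using upper[of y h] upper[of "y + h" k] by (simp add: add.assoc)
    qed
    show "\<exists>T. finite T \<and> (\<forall>y. \<exists>t\<in>T. \<rho> (y - t) < \<epsilon>)" if "\<epsilon> > 0" for \<epsilon>
    proof -
      obtain V where V: "open V" "0 \<in> V" "\<And>h. h \<in> V \<Longrightarrow> \<rho> h < \<epsilon>" using small[OF \<open>\<epsilon> > 0\<close>] by blast
      have "open ((\<lambda>y. y - t) -` V)" for t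
        by (rule open_vimage[OF V(1)]) (intro continuous_intros)
      moreover have "UNIV \<subseteq> (\<Union>t. (\<lambda>y. y - t) -` V)" using V(2) by (auto intro: exI[of _ "_ :: 'x"])
      ultimately obtain T where "finite T" "UNIV \<subseteq> (\<Union>t\<in>T. (\<lambda>y. y - t) -` V)"
        using compactE_image[OF assms(1), of UNIV "\<lambda>t. (\<lambda>y. y - t) -` V"] by metis
      moreover from this have "\<exists>t\<in>T. \<rho> (y - t) < \<epsilon>" for y using V(3) by blast
      ultimately show ?thesis by blast
    qed
  qed
  moreover have "\<rho> x > 0" using upper[of 0 x] f(2) by simp
  ultimately show thesis using that small by blast
qed

text \<open>A character that is Lipschitz for \<open>\<rho>\<close> is continuous, because
  \<open>\<rho>\<close> is small near 0.\<close>

theorem characters_separate_points: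
  fixes x :: "'x::topological_ab_group_add"
  assumes "compact (UNIV :: 'x set)" "metrizable_space (euclidean :: 'x topology)" "x \<noteq> 0"
  obtains \<phi> where "\<phi> \<in> pontryagin_dual" "\<phi> x \<noteq> 1"
proof -
  obtain \<rho> :: "'x \<Rightarrow> real" where \<rho>: "totally_bounded_seminorm \<rho>" "\<rho> x > 0"
    and small: "\<And>\<epsilon>. \<epsilon> > 0 \<Longrightarrow> \<exists>V. open V \<and> 0 \<in> V \<and> (\<forall>h\<in>V. \<rho> h < \<epsilon>)"
    by (rule separating_seminorm[OF assms]) (rule that)
  interpret totally_bounded_seminorm \<rho> by (rule \<rho>(1))
  obtain C and \<psi> :: "'x \<Rightarrow> complex" where \<psi>: "\<And>g. norm (\<psi> g) = 1" "\<And>g h. \<psi> (g + h) = \<psi> g * \<psi> h"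
    "\<And>g. norm (\<psi> g - 1) \<le> C * \<rho> g" "\<psi> x \<noteq> 1"
    using lipschitz_character[OF \<rho>(2)] by metis
  have "continuous_on UNIV \<psi>"
    unfolding continuous_on_def
  proof (intro ballI tendstoI)
    fix y and \<epsilon> :: real assume "\<epsilon> > 0"
    \<comment> \<open>The denominator \<open>\<bar>C\<bar> + 1\<close> is positive whatever the sign
      of \<open>C\<close>.\<close>
    then obtain V where V: "open V" "0 \<in> V" "\<And>h. h \<in> V \<Longrightarrow> \<rho> h < \<epsilon> / (\<bar>C\<bar> + 1)"
      using small[of "\<epsilon> / (\<bar>C\<bar> + 1)"] by auto
    have "open ((\<lambda>z. z - y) -` V)"
      by (rule open_vimage[OF V(1)]) (intro continuous_intros)
    then have "\<forall>\<^sub>F z in at y. z \<in> (\<lambda>z. z - y) -` V" using V(2) by (intro eventually_at_topological[THEN iffD2]) auto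
    then show "\<forall>\<^sub>F z in at y. dist (\<psi> z) (\<psi> y) < \<epsilon>"
    proof (rule eventually_mono)
      fix z assume "z \<in> (\<lambda>z. z - y) -` V"
      then have z: "\<rho> (z - y) < \<epsilon> / (\<bar>C\<bar> + 1)" using V(3) by simp
      have "\<psi> z - \<psi> y = (\<psi> (z - y) - 1) * \<psi> y"
        using \<psi>(2)[of "z - y" y] by (simp add: left_diff_distrib)
      then have "dist (\<psi> z) (\<psi> y) \<le> C * \<rho> (z - y)" using \<psi>(1,3) by (simp add: dist_norm norm_mult)
      also have "\<dots> \<le> (\<bar>C\<bar> + 1) * \<rho> (z - y)" using nonneg by (intro mult_right_mono) auto
      also have "\<dots> < \<epsilon>" using z by (simp add: field_simps)
      finally show "dist (\<psi> z) (\<psi> y) < \<epsilon>" .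
    qed
  qed
  then have "\<psi> \<in> pontryagin_dual" using \<psi> by (simp add: pontryagin_dual_def)
  then show thesis using that \<psi>(4) by blast
qed

text \<open>The complement of \<open>V\<close> is compact and avoids 0, so finitely many of the open
  sets where a character stays away from 1 cover it.\<close>

lemma dual_neighbourhood_base:
  fixes V :: "'x::topological_ab_group_add set"
  assumes "compact (UNIV :: 'x set)" "metrizable_space (euclidean :: 'x topology)" "open V" "0 \<in> V"
  obtains \<Phi> \<delta> where "finite \<Phi>" "\<Phi> \<subseteq> pontryagin_dual" "\<delta> > 0"
    "\<And>y. (\<And>\<phi>. \<phi> \<in> \<Phi> \<Longrightarrow> norm (\<phi> y - 1) < \<delta>) \<Longrightarrow> y \<in> V"
proof -
  have "compact (- V)"
    using assms(1,3) compact_Int_closed[of UNIV "- V"] by (simp add: closed_Compl)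
  define W where "W \<phi> n = {y :: 'x. norm (\<phi> y - 1) > 1 / real (Suc n)}" for \<phi> :: "'x \<Rightarrow> complex" and n
  have "open (W (fst p) (snd p))" if "p \<in> pontryagin_dual \<times> UNIV" for p
    using that unfolding W_def pontryagin_dual_def
    by (auto intro!: open_Collect_less continuous_intros)
  moreover have "- V \<subseteq> (\<Union>p\<in>pontryagin_dual \<times> UNIV. W (fst p) (snd p))"
  proof
    fix y assume "y \<in> - V"
    then have "y \<noteq> 0" using assms(4) by auto
    then obtain \<phi> where \<phi>: "\<phi> \<in> pontryagin_dual" "\<phi> y \<noteq> 1"
      using characters_separate_points[OF assms(1,2)] by blast
    then obtain n where "inverse (real (Suc n)) < norm (\<phi> y - 1)"
      using reals_Archimedean[of "norm (\<phi> y - 1)"] by auto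
    then have "y \<in> W \<phi> n" by (simp add: W_def inverse_eq_divide)
    then show "y \<in> (\<Union>p\<in>pontryagin_dual \<times> UNIV. W (fst p) (snd p))" using \<phi>(1) by force
  qed
  ultimately obtain P where P: "P \<subseteq> pontryagin_dual \<times> UNIV" "finite P" "- V \<subseteq> (\<Union>p\<in>P. W (fst p) (snd p))"
    using compactE_image[OF \<open>compact (- V)\<close>, of "pontryagin_dual \<times> UNIV" "\<lambda>p. W (fst p) (snd p)"] by metis
  \<comment> \<open>The inserted 1 handles an empty cover, as when \<open>V\<close> is
    everything.\<close>
  define \<delta> where "\<delta> = Min (insert 1 ((\<lambda>p. 1 / real (Suc (snd p))) ` P))"
  show thesis
  proof
    show "finite (fst ` P)" "fst ` P \<subseteq> pontryagin_dual" using P by auto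
    show "\<delta> > 0" using P(2) by (auto simp: \<delta>_def)
    fix y assume y: "\<And>\<phi>. \<phi> \<in> fst ` P \<Longrightarrow> norm (\<phi> y - 1) < \<delta>"
    show "y \<in> V"
    proof (rule ccontr)
      assume "y \<notin> V"
      then obtain p where p: "p \<in> P" "norm (fst p y - 1) > 1 / real (Suc (snd p))"
        using P(3) by (auto simp: W_def)
      moreover have "\<delta> \<le> 1 / real (Suc (snd p))" using p(1) P(2) by (auto simp: \<delta>_def intro!: Min_le)
      ultimately show False using y[of "fst p"] by auto
    qed
  qed
qed

lemma dual_diff:
  assumes "\<phi> \<in> pontryagin_dual"
  shows "\<phi> 0 = 1" "\<phi> (y - z) = \<phi> y / \<phi> z"
proof -
  have mult: "\<And>y z. \<phi> (y + z) = \<phi> y * \<phi> z" using assms by (simp add: pontryagin_dual_def)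
  show "\<phi> 0 = 1" using mult[of 0 0] dual_nonzero[OF assms, of 0] by simp
  show "\<phi> (y - z) = \<phi> y / \<phi> z" using mult[of "y - z" z] dual_nonzero[OF assms, of z] by (simp add: field_simps)
qed

lemma dual_sum_le:
  assumes "\<phi> \<in> pontryagin_dual"
  shows "norm (\<phi> (\<Sum>i\<in>I. z i) - 1) \<le> (\<Sum>i\<in>I. norm (\<phi> (z i) - 1))"
proof (induction I rule: infinite_finite_induct)
  case (insert i I)
  have "\<phi> (\<Sum>i\<in>insert i I. z i) - 1 = \<phi> (z i) * (\<phi> (\<Sum>i\<in>I. z i) - 1) + (\<phi> (z i) - 1)"
    using assms insert by (simp add: pontryagin_dual_def algebra_simps)
  also have "norm \<dots> \<le> norm (\<phi> (\<Sum>i\<in>I. z i) - 1) + norm (\<phi> (z i) - 1)"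
    using assms norm_triangle_ineq[of "\<phi> (z i) * (\<phi> (\<Sum>i\<in>I. z i) - 1)"]
    by (simp add: pontryagin_dual_def norm_mult)
  finally show ?case using insert by simp
qed (simp_all add: dual_diff[OF assms])

section \<open>Independence sets\<close>

text \<open>Take a maximal separated \<open>H\<close>. By maximality and symmetry of
  \<open>E\<close>, every element of \<open>F\<close> has the form \<open>e + s\<close> with
  \<open>e \<in> E\<close> and \<open>s \<in> H\<close>.\<close>

lemma separated_subset:
  fixes E F :: "'g::group_add set"
  assumes "finite E" "0 \<in> E" "\<And>g. g \<in> E \<Longrightarrow> - g \<in> E" "finite F"
  obtains F' where "F' \<subseteq> F" "\<And>s t. s \<in> F' \<Longrightarrow> t \<in> F' \<Longrightarrow> s \<noteq> t \<Longrightarrow> t - s \<notin> E"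
    "card F \<le> card E * card F'"
proof -
  define Q where "Q H \<longleftrightarrow> H \<subseteq> F \<and> (\<forall>s\<in>H. \<forall>t\<in>H. s \<noteq> t \<longrightarrow> t - s \<notin> E)" for H
  have "finite {H. Q H}" by (rule finite_subset[of _ "Pow F"]) (auto simp: Q_def assms)
  moreover have "Q {}" by (simp add: Q_def)
  ultimately obtain H where H: "Q H" "\<And>H'. Q H' \<Longrightarrow> H \<subseteq> H' \<Longrightarrow> H = H'"
    using finite_has_maximal[of "{H. Q H}"] by auto
  have "F \<subseteq> (\<lambda>(e, s). e + s) ` (E \<times> H)"
  proof
    fix t assume t: "t \<in> F"
    have "\<exists>s\<in>H. t - s \<in> E"
    proof (rule ccontr)
      assume not: "\<not> (\<exists>s\<in>H. t - s \<in> E)"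
      then have "s - t \<notin> E" if "s \<in> H" for s using that assms(3)[of "s - t"] by auto
      then have "Q (insert t H)" using H(1) t not by (auto simp: Q_def)
      then have "t \<in> H" using H(2)[of "insert t H"] by blast
      then show False using not assms(2) by auto
    qed
    then obtain s where "s \<in> H" "t - s \<in> E" by blast
    then show "t \<in> (\<lambda>(e, s). e + s) ` (E \<times> H)" by (intro image_eqI[of _ _ "(t - s, s)"]) auto
  qed
  moreover have fin: "finite H" using H(1) assms(4) finite_subset by (auto simp: Q_def)
  ultimately have "card F \<le> card (E \<times> H)" by (intro surj_card_le) (use assms in auto)
  then show thesis using that[of H] H(1) by (auto simp: Q_def card_cartesian_product)
qed

lemma summable_tail_bound:
  fixes f :: "'a \<Rightarrow> real"
  assumes "f summable_on UNIV" "\<And>a. f a \<ge> 0" "\<delta> > 0"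
  obtains E where "finite E" "\<And>H. finite H \<Longrightarrow> H \<inter> E = {} \<Longrightarrow> sum f H < \<delta>"
proof -
  obtain E where E: "finite E" "dist (sum f E) (infsum f UNIV) < \<delta>"
    using infsum_finite_approximation[OF assms(1), of "\<delta>/2"] assms(3) by force
  have "sum f H < \<delta>" if "finite H" "H \<inter> E = {}" for H
  proof -
    have "sum f H + sum f E = sum f (H \<union> E)" using that E by (simp add: sum.union_disjoint)
    also have "\<dots> \<le> infsum f UNIV"
      using that E assms by (intro finite_sum_le_infsum) auto
    finally show ?thesis using E(2) by (simp add: dist_real_def)
  qed
  then show thesis using that E(1) by blast
qed

theorem theorem7p8:
  fixes act :: "'g::{group_add, countable} \<Rightarrow> 'x::topological_ab_group_add \<Rightarrow> 'x"
  assumes "amenable TYPE('g)"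
    and "compact (UNIV :: 'x set)"
    and "metrizable_space (euclidean :: 'x topology)"
    and "acts_by_automorphisms act"
    and "dual_finitely_generated act"
  shows "Delta1 act \<subseteq> IE act"
proof
  fix x assume x: "x \<in> Delta1 act"
  have act: "\<And>y. act 0 y = y" "\<And>s t y. act (s + t) y = act s (act t y)"
    "\<And>s y z. act s (y + z) = act s y + act s z"
    using assms(4) by (auto simp: acts_by_automorphisms_def)
  have act_zero: "act s 0 = 0" for s using act(3)[of s 0 0] by simp
  have act_sum: "act s (\<Sum>i\<in>I. z i) = (\<Sum>i\<in>I. act s (z i))" for s and I :: "'g set" and z
    by (induction I rule: infinite_finite_induct) (auto simp: act act_zero)
  have in_image: "y \<in> act (- s) ` U" if "act s y \<in> U" for s y U
    using that act(1)[of y] act(2)[of "- s" s y] by (intro image_eqI[of _ _ "act s y"]) auto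
  show "x \<in> IE act"
    unfolding IE_def
  proof (intro CollectI allI impI)
    fix U1 U2 :: "'x set" assume U: "x \<in> interior U1 \<and> 0 \<in> interior U2"
    \<comment> \<open>Both requirements become one neighbourhood of 0: a perturbation
      \<open>v \<in> V\<close> has \<open>v \<in> U2\<close> and
      \<open>v + x \<in> U1\<close>.\<close>
    define V where "V = interior U2 \<inter> (\<lambda>y. y + x) -` interior U1"
    have "open V"
      unfolding V_def by (intro open_Int open_vimage open_interior continuous_intros)
    moreover have "0 \<in> V" using U by (simp add: V_def)
    ultimately obtain \<Phi> \<delta> where \<Phi>: "finite \<Phi>" "\<Phi> \<subseteq> pontryagin_dual" "\<delta> > 0"
      "\<And>y. (\<And>\<phi>. \<phi> \<in> \<Phi> \<Longrightarrow> norm (\<phi> y - 1) < \<delta>) \<Longrightarrow> y \<in> V"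
      using dual_neighbourhood_base[OF assms(2,3)] by metis
    have "(\<lambda>s. norm (Psi act x \<phi> s)) summable_on UNIV" if "\<phi> \<in> \<Phi>" for \<phi>
      using x \<Phi>(2) that by (auto simp: Delta1_def)
    then have "\<exists>E. finite E \<and> (\<forall>H. finite H \<longrightarrow> H \<inter> E = {} \<longrightarrow> (\<Sum>s\<in>H. norm (Psi act x \<phi> s)) < \<delta>)"
      if "\<phi> \<in> \<Phi>" for \<phi>
      using that summable_tail_bound[of "\<lambda>s. norm (Psi act x \<phi> s)" \<delta>] \<Phi>(3) by (metis norm_ge_zero)
    then obtain T where T: "\<And>\<phi>. \<phi> \<in> \<Phi> \<Longrightarrow> finite (T \<phi>)"
      "\<And>\<phi> H. \<phi> \<in> \<Phi> \<Longrightarrow> finite H \<Longrightarrow> H \<inter> T \<phi> = {} \<Longrightarrow> (\<Sum>s\<in>H. norm (Psi act x \<phi> s)) < \<delta>"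
      by metis
    \<comment> \<open>The exceptional sets of all \<open>\<phi> \<in> \<Phi>\<close>, made symmetric
      and enlarged by 0 for \<open>separated_subset\<close>.\<close>
    define E where "E = insert 0 (\<Union>(T ` \<Phi>) \<union> uminus ` \<Union>(T ` \<Phi>))"
    have E: "finite E" "0 \<in> E" "\<And>g. g \<in> E \<Longrightarrow> - g \<in> E"
      using \<Phi>(1) T(1) by (auto simp: E_def)
    have E_pos: "card E > 0" using E by (auto simp: card_gt_0_iff)
    have indep: "independence_set act U1 U2 F'"
      if F': "finite F'" "\<And>s t. s \<in> F' \<Longrightarrow> t \<in> F' \<Longrightarrow> s \<noteq> t \<Longrightarrow> t - s \<notin> E" for F'
      unfolding independence_set_def
    proof (intro conjI ballI F'(1))
      fix \<sigma> assume "\<sigma> \<in> F' \<rightarrow> {1, 2::nat}"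
      define G where "G = {s\<in>F'. \<sigma> s = 1}"
      \<comment> \<open>The common witness for \<open>\<sigma>\<close>. Applying \<open>t\<close>
        gives the sum of the \<open>act (t - s) x\<close>: the term \<open>s = t\<close>, present
        exactly when \<open>\<sigma> t = 1\<close>, is \<open>x\<close>, and the others form the
        small error \<open>v\<close>.\<close>
      define y where "y = (\<Sum>s\<in>G. act (- s) x)"
      have "y \<in> act (- t) ` (if \<sigma> t = 1 then U1 else U2)" if t: "t \<in> F'" for t
      proof -
        define v where "v = (\<Sum>s\<in>G - {t}. act (t - s) x)"
        have "v \<in> V"
        proof (rule \<Phi>(4))
          fix \<phi> assume \<phi>: "\<phi> \<in> \<Phi>"
          have inj: "inj_on (\<lambda>s. t - s) (G - {t})" 
            by (simp add: inj_on_def diff_conv_add_uminus del: add_uminus_conv_diff)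
          have "norm (\<phi> v - 1) \<le> (\<Sum>s\<in>G - {t}. norm (Psi act x \<phi> (t - s)))"
            unfolding v_def Psi_def using \<phi> \<Phi>(2) by (intro dual_sum_le) auto
          also have "\<dots> = (\<Sum>g\<in>(\<lambda>s. t - s) ` (G - {t}). norm (Psi act x \<phi> g))"
            by (simp add: sum.reindex[OF inj])
          \<comment> \<open>The quotients \<open>t - s\<close> are distinct and avoid
            \<open>E\<close>, so this is part of a summable tail.\<close>
          also have "\<dots> < \<delta>"
          proof (rule T(2)[OF \<phi>])
            show "finite ((\<lambda>s. t - s) ` (G - {t}))" using F'(1) by (simp add: G_def)
            have "t - s \<notin> T \<phi>" if "s \<in> G - {t}" for s
              using F'(2)[of s t] that t \<phi> by (auto simp: G_def E_def)
            then show "(\<lambda>s. t - s) ` (G - {t}) \<inter> T \<phi> = {}" by auto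
          qed
          finally show "norm (\<phi> v - 1) < \<delta>" .
        qed
        then have v: "v \<in> U2" "v + x \<in> U1" using interior_subset by (auto simp: V_def)
        have "act t y = (\<Sum>s\<in>G. act (t - s) x)"
          unfolding y_def act_sum by (simp flip: act(2))
        also have "\<dots> = (if \<sigma> t = 1 then v + x else v)"
          using F'(1) t by (auto simp: v_def G_def sum.remove[of _ t] act(1) add.commute intro!: sum.cong)
        finally show ?thesis using v by (intro in_image) auto
      qed
      then show "(\<Inter>s\<in>F'. act (- s) ` (if \<sigma> s = 1 then U1 else U2)) \<noteq> {}" by blast
    qed
    show "\<exists>K c \<epsilon>. finite K \<and> K \<noteq> {} \<and> c > 0 \<and> \<epsilon> > 0 \<and>
           (\<forall>F. finite F \<and> real (card ((K + F) - F)) \<le> \<epsilon> * real (card F) \<longrightarrow>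
              (\<exists>F'\<subseteq>F. independence_set act U1 U2 F' \<and> real (card F') \<ge> c * real (card F)))"
    \<comment> \<open>With \<open>K = {0}\<close> the set \<open>(K + F) - F\<close> is empty, so
      every finite \<open>F\<close> has to be treated; \<open>separated_subset\<close> does this
      with density \<open>1 / real (card E)\<close>.\<close>
    proof (rule exI[of _ "{0}"], rule exI[of _ "1 / real (card E)"], rule exI[of _ 1], intro conjI allI impI)
      fix F :: "'g set" assume "finite F \<and> real (card (({0} + F) - F)) \<le> 1 * real (card F)"
      then have F: "finite F" by simp
      obtain F' where F': "F' \<subseteq> F" "\<And>s t. s \<in> F' \<Longrightarrow> t \<in> F' \<Longrightarrow> s \<noteq> t \<Longrightarrow> t - s \<notin> E"
        "card F \<le> card E * card F'"
        using separated_subset[OF E F] by blast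
      have "real (card F) \<le> real (card E) * real (card F')"
        using F'(3) by (simp flip: of_nat_mult)
      then have "1 / real (card E) * real (card F) \<le> real (card F')"
        using E_pos by (simp add: field_simps)
      moreover have "independence_set act U1 U2 F'"
        by (rule indep[OF finite_subset[OF F'(1) F] F'(2)])
      ultimately show "\<exists>F'\<subseteq>F. independence_set act U1 U2 F' \<and> 1 / real (card E) * real (card F) \<le> real (card F')"
        using F'(1) by blast
    qed (use E_pos in auto)
  qed
qed

end
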